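(* Let $d\ge1$ and $\mathbf r=(r_1,\dots,r_d)\in\mathbb N^d$, $\mathbf r\ne0$. For all $m,m'\in\mathcal M_{\mathbf r}$, with $h_m,h_{m'}$ as defined in the context, $$\kappa_{m\cup m'}(h_m\wedge h_{m'})\ge\left[4\left(1+4\sqrt{\prod_{i=1}^d(r_i+1)}\right)\right]^{-1}.$$
   Context: $\mu$ is Lebesgue measure on $\mathbb R^d$, $\|\cdot\|_{\infty,\mu}$ the essential supremum norm. $\mathcal C_{rec}=\{\prod_{i=1}^d(a_i,b_i):a_i<b_i\}$ is the class of open rectangles with sides parallel to the axes. For $f\in L_1(\mathbb R^d)$ and $h>0$, $|f|_h=\sup_{C\in\mathcal C_{rec}}\frac1{\mu(C)+h}|\int_Cf\,d\mu|$. For $m\subset L_1(\mathbb R^d)\cap L_\infty(\mathbb R^d)$, $\kappa_m(h)=\inf_{p,q\in m}\frac{|p-q|_h}{\|p-q\|_{\infty,\mu}}$ (ratio $0/0:=1$). For $\mathbf j\in\mathbb Z^d$, $\mathcal I(\mathbf j)=\{\prod_{i=1}^d[k_i2^{-j_i},(k_i+1)2^{-j_i}):\mathbf k\in\mathbb Z^d\}$. For a partition $\mathcal I$ of $\mathbb R^d$, $m_{dir}(\mathbf r,\mathcal I)$ is the set of functions $\sum_{I\in\mathcal I}f_I\mathbf 1_I$ where each $f_I$ is a polynomial on $\mathbb R^d$ with rational coefficients whose degree in the variable $x_i$ is at most $r_i$ for every $i$, and $\{I:f_I\ne0\}$ is finite. $\mathcal M_{\mathbf r}=\{m_{dir}(\mathbf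 r,\mathcal I(\mathbf j)):\mathbf j\in\mathbb Z^d\}$. For $m=m_{dir}(\mathbf r,\mathcal I(\mathbf j))$, $$h_m=\frac{2^{-(j_1+\dots+j_d)}}{(2\|\mathbf r\|_1^2)^d\,4^{d+1}},\qquad\|\mathbf r\|_1=\sum_{i=1}^dr_i.$$ *)

theory Defs
  imports "HOL-Probability.Essential_Supremum"
begin

definition open_rectangles :: "(real^'d) set set" where
  "open_rectangles = {box a b | a b. \<forall>i. a $ i < b $ i}"

text \<open>The quantities below take values in \<^typ>\<open>ennreal\<close>, so that suprema and infima
  need no boundedness or nonemptiness side conditions.\<close>

definition rect_norm :: "real \<Rightarrow> (real^'d \<Rightarrow> real) \<Rightarrow> ennreal" where
  "rect_norm h f =
     (SUP C\<in>open_rectangles. ennreal (\<bar>LINT x:C|lborel. f x\<bar> / (measure lborel C + h)))"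

definition ess_norm :: "(real^'d \<Rightarrow> real) \<Rightarrow> ennreal" where
  "ess_norm f = esssup lborel (\<lambda>x. ennreal \<bar>f x\<bar>)"

definition norm_ratio :: "real \<Rightarrow> (real^'d \<Rightarrow> real) \<Rightarrow> ennreal" where
  "norm_ratio h f =
     (if rect_norm h f = 0 \<and> ess_norm f = 0 then 1 else rect_norm h f / ess_norm f)"

definition kappa :: "(real^'d \<Rightarrow> real) set \<Rightarrow> real \<Rightarrow> ennreal" where
  "kappa m h = (INF p\<in>m. INF q\<in>m. norm_ratio h (\<lambda>x. p x - q x))"

definition dyadic_partition :: "int^'d \<Rightarrow> (real^'d) set set" where
  "dyadic_partition j =
     {{x. \<forall>i. of_int (k $ i) * 2 powi (- (j $ i)) \<le> x $ i \<and>
              x $ i < (of_int (k $ i) + 1) * 2 powi (- (j $ i))} | k :: int^'d. True}"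

text \<open>Polynomials are represented by the functions they induce; the set of exponents
  \<open>k\<close> summed over is finite.\<close>

definition rat_polys :: "nat^'d \<Rightarrow> (real^'d \<Rightarrow> real) set" where
  "rat_polys r =
     {(\<lambda>x. \<Sum>k | \<forall>i. k i \<le> r $ i. of_rat (c k) * (\<Prod>i\<in>UNIV. (x $ i) ^ k i))
      | c :: ('d \<Rightarrow> nat) \<Rightarrow> rat. True}"

lemma finite_exponents: "finite {k :: 'd::finite \<Rightarrow> nat. \<forall>i. k i \<le> r $ i}"
proof -
  have "{k :: 'd \<Rightarrow> nat. \<forall>i. k i \<le> r $ i} = (\<Pi>\<^sub>E i\<in>UNIV. {..r $ i})"
    by (auto simp: PiE_def)
  then show ?thesis by (simp add: finite_PiE)
qed

definition m_dir :: "nat^'d \<Rightarrow> (real^'d) set set \<Rightarrow> (real^'d \<Rightarrow> real) set" where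
  "m_dir r P =
     {(\<lambda>x. \<Sum>I | I \<in> P \<and> f I \<noteq> (\<lambda>_. 0). f I x * indicator I x)
      | f. (\<forall>I\<in>P. f I \<in> rat_polys r) \<and> finite {I \<in> P. f I \<noteq> (\<lambda>_. 0)}}"

text \<open>The threshold \<open>h\<^sub>m\<close> of the model \<open>m = m_dir r (dyadic_partition j)\<close>,
  as a function of the parameters \<open>r\<close> and \<open>j\<close> of \<open>m\<close>.\<close>

definition model_h :: "nat^'d \<Rightarrow> int^'d \<Rightarrow> real" where
  "model_h r j =
     2 powi (- (\<Sum>i\<in>UNIV. j $ i)) /
     ((2 * real (\<Sum>i\<in>UNIV. r $ i) ^ 2) ^ CARD('d) * 4 ^ (CARD('d) + 1))"

end

theory Submission
  imports Defs
begin

text \<open>Let \<open>f = p - q\<close> with \<open>p\<close> on the grid \<open>j\<close>, \<open>q\<close> on the grid \<open>j'\<close>, and \<open>A = \<bar>f\<bar>\<^sub>h\<close>.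
  Boxes whose sides are the fraction \<open>1 / (8 \<parallel>r\<parallel>\<^sub>1\<^sup>2)\<close> of those of a cell of either grid have
  volume at least \<open>4 h\<close>, so the mean of \<open>f\<close> over them is at most \<open>5/4 A\<close>. By Markov's inequality
  a polynomial on a cell whose means over all these subboxes are at most \<open>K\<close> is bounded by
  \<open>2 K\<close> on the cell.

  The common refinement of the two grids may have cells far smaller than \<open>h\<close>. Let \<open>T\<close> contain the
  directions in which \<open>j\<close> is coarser. On a cell of the common coarsening of the grids, interpolate
  the window integrals of \<open>q\<close> in the directions of \<open>T\<close> at Fekete points. This gives a polynomial
  \<open>q1\<close> such that the means of \<open>p - q1\<close> over windows of the grid \<open>j\<close> are interpolated from means
  of \<open>f\<close>; hence they are at most \<open>5/4 A D\<close> with \<open>D = \<Prod>i\<in>T. r $ i + 1\<close>, since the Lagrange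
  polynomials at Fekete points are bounded by 1. So \<open>\<bar>p - q1\<bar> \<le> 5/2 A D\<close>. Then the means of
  \<open>q1 - q\<close> over windows of the grid \<open>j'\<close> are bounded, and \<open>q1 - q\<close> is bounded as well.
  Exchanging \<open>p\<close> and \<open>q\<close> if necessary, \<open>D\<close> is at most the square root of the full product.\<close>

section \<open>Markov's inequality\<close>

text \<open>Chebyshev polynomials of the first kind; they serve as the extremal comparison
  polynomials for the derivative at an endpoint of \<open>[-1, 1]\<close>.\<close>

fun cheb :: "nat \<Rightarrow> real poly" where
  "cheb 0 = 1"
| "cheb (Suc 0) = [:0, 1:]"
| "cheb (Suc (Suc n)) = [:0, 2:] * cheb (Suc n) - cheb n"

lemma degree_cheb: "degree (cheb n) \<le> n"
proof (induction n rule: cheb.induct)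
  case (3 n)
  have "degree ([:0, 2:] * cheb (Suc n)) \<le> 1 + Suc n"
    using degree_mult_le[of "[:0, 2:]" "cheb (Suc n)"] 3 by simp
  then show ?case
    using 3 by (auto intro!: degree_diff_le)
qed auto

lemma poly_cheb_cos: "poly (cheb n) (cos t) = cos (real n * t)"
proof (induction n rule: cheb.induct)
  case (3 n)
  have "cos (real (Suc n) * t + t) + cos (real (Suc n) * t - t)
      = 2 * cos t * cos (real (Suc n) * t)"
    by (simp add: cos_add cos_diff)
  moreover have "real (Suc (Suc n)) * t = real (Suc n) * t + t" "real n * t = real (Suc n) * t - t"
    by (auto simp: algebra_simps)
  ultimately show ?case
    using 3 by simp
qed auto

lemma poly_cheb_1: "poly (cheb n) 1 = 1"
  using poly_cheb_cos[of n 0] by simp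

lemma pderiv_cheb_1: "poly (pderiv (cheb n)) 1 = (real n)\<^sup>2"
proof (induction n rule: cheb.induct)
  case (3 n)
  then show ?case
    by (simp add: pderiv_diff pderiv_mult pderiv_smult pderiv_pCons poly_cheb_1 algebra_simps power2_eq_square)
qed (auto simp: pderiv_pCons)

text \<open>If the derivative were larger, some multiple of \<open>P\<close> with sup norm below 1
  would have the same derivative at 1 as \<open>cheb n\<close>. The difference of the two alternates
  in sign at the \<open>n + 1\<close> extrema of \<open>cheb n\<close>, so by Rolle's theorem its
  derivative has too many zeros.\<close>

lemma pderiv_at_1_bound:
  fixes P :: "real poly"
  assumes deg: "degree P \<le> n" and bnd: "\<And>x. -1 \<le> x \<Longrightarrow> x \<le> 1 \<Longrightarrow> \<bar>poly P x\<bar> \<le> G"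
  shows "poly (pderiv P) 1 \<le> (real n)\<^sup>2 * G"
proof (rule ccontr)
  assume "\<not> ?thesis"
  then have gt: "poly (pderiv P) 1 > (real n)\<^sup>2 * G" by simp
  have G0: "0 \<le> G" using bnd[of 0] by simp
  have n0: "n > 0"
  proof (rule ccontr)
    assume "\<not> n > 0"
    then have "pderiv P = 0" using deg by (simp add: pderiv_eq_0_iff)
    then show False using gt \<open>\<not> n > 0\<close> by simp
  qed
  define D where "D = poly (pderiv P) 1"
  have D0: "D > 0" using gt G0 unfolding D_def by (smt (verit) mult_nonneg_nonneg zero_le_power2)
  \<comment> \<open>This factor makes the derivatives of \<open>smult c P\<close> and
    \<open>cheb n\<close> agree at 1, so that \<open>pderiv Q\<close> vanishes there.\<close>
  define c where "c = (real n)\<^sup>2 / D"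
  define Q where "Q = cheb n - smult c P"
  have c0: "c > 0" using n0 D0 by (simp add: c_def)
  have cG: "c * G < 1" using gt D0 unfolding c_def D_def by (simp add: field_simps)
  have small: "\<bar>c * poly P x\<bar> < 1" if "-1 \<le> x" "x \<le> 1" for x
  proof -
    have "\<bar>c * poly P x\<bar> \<le> c * G" using bnd[OF that] c0 by (simp add: abs_mult)
    then show ?thesis using cG by simp
  qed
  \<comment> \<open>For \<open>k\<close> from 0 to \<open>n\<close> these are the extrema of
    \<open>cheb n\<close>, in decreasing order from 1 to -1.\<close>
  define x where "x k = cos (real k * pi / real n)" for k
  have xb: "-1 \<le> x k" "x k \<le> 1" for k by (auto simp: x_def)
  have xdec: "x (Suc k) < x k" if "k < n" for k
    unfolding x_def
  proof (rule cos_monotone_0_pi)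
    show "real (Suc k) * pi / real n \<le> pi"
      using that by (simp add: divide_simps)
    show "real k * pi / real n < real (Suc k) * pi / real n"
      using n0 by (simp add: divide_simps)
  qed (use n0 in auto)
  have Tx: "poly (cheb n) (x k) = (-1) ^ k" for k
    unfolding x_def poly_cheb_cos using n0 by (simp add: cos_npi)
  have Qx: "(-1) ^ k * poly Q (x k) > 0" for k
  proof -
    have "(-1) ^ k * poly Q (x k) = 1 - (-1) ^ k * (c * poly P (x k))"
      by (simp add: Q_def Tx algebra_simps flip: power_add)
    moreover have "\<bar>(-1) ^ k * (c * poly P (x k))\<bar> < 1"
      using small[OF xb] by (simp add: abs_mult power_abs)
    ultimately show ?thesis by linarith
  qed
  have "\<exists>z. x (Suc k) < z \<and> z < x k \<and> poly Q z = 0" if "k < n" for k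
  proof -
    have "0 < ((-1) ^ k * poly Q (x k)) * ((-1) ^ Suc k * poly Q (x (Suc k)))"
      by (rule mult_pos_pos[OF Qx Qx])
    also have "\<dots> = - (poly Q (x (Suc k)) * poly Q (x k))"
      by (simp add: algebra_simps flip: power_add)
    finally show ?thesis using poly_IVT[OF xdec[OF that], of Q] by auto
  qed
  then obtain z where z: "\<And>k. k < n \<Longrightarrow> x (Suc k) < z k \<and> z k < x k \<and> poly Q (z k) = 0"
    by metis
  have "\<exists>w. z (Suc k) < w \<and> w < z k \<and> poly (pderiv Q) w = 0" if "Suc k < n" for k
  proof -
    have "z (Suc k) < z k" using z[of k] z[of "Suc k"] that by force
    from poly_MVT[OF this, of Q] show ?thesis using z[of k] z[of "Suc k"] that by auto
  qed
  then obtain w where w: "\<And>k. Suc k < n \<Longrightarrow> z (Suc k) < w k \<and> w k < z k \<and> poly (pderiv Q) (w k) = 0"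
    by metis
  \<comment> \<open>The \<open>n - 1\<close> zeros found by Rolle's theorem lie strictly below 1.
    Together with 1 there are \<open>n\<close> zeros, more than the degree of a nonzero
    \<open>pderiv Q\<close> admits.\<close>
  define W where "W = insert 1 (w ` {..<n-1})"
  have wdec: "w l < w k" if "k < l" "Suc l < n" for k l
    using that
  proof (induction l)
    case (Suc l)
    have "w (Suc l) < w l" using w[of l] w[of "Suc l"] Suc by force
    then show ?case using Suc by (cases "k = l") auto
  qed auto
  have "inj_on w {..<n-1}"
  proof (rule inj_onI)
    fix a b assume *: "a \<in> {..<n-1}" "b \<in> {..<n-1}" "w a = w b"
    then have "Suc a < n" "Suc b < n" by auto
    then show "a = b"
      using wdec[of a b] wdec[of b a] * by (cases a b rule: linorder_cases) auto
  qed
  moreover have "1 \<notin> w ` {..<n-1}"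
  proof
    assume "1 \<in> w ` {..<n-1}"
    then obtain k where "Suc k < n" "w k = 1" by force
    then show False using w[of k] z[of k] xb(2)[of k] by force
  qed
  ultimately have cardW: "card W = n"
    using n0 by (simp add: W_def card_image)
  have WQ: "poly (pderiv Q) v = 0" if "v \<in> W" for v
  proof -
    have "poly (pderiv Q) 1 = 0"
      using D0 by (simp add: Q_def pderiv_diff pderiv_smult pderiv_cheb_1 c_def D_def)
    then show ?thesis using that w by (auto simp: W_def)
  qed
  have "degree Q \<le> n"
    unfolding Q_def using degree_cheb deg degree_smult_le[of c P] by (intro degree_diff_le) auto
  then have "degree (pderiv Q) < n" using n0 by (simp add: degree_pderiv)
  then have "pderiv Q = 0"
    using poly_eqI_degree[of W "pderiv Q" 0] WQ cardW by simp
  then have "poly Q (x 0) = poly Q (x 1)"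
    by (metis degree_eq_zeroE pderiv_eq_0_iff mult_zero_right poly_0 poly_pCons)
  then show False using Qx[of 0] Qx[of 1] by simp
qed

lemma pderiv_at_1_bound_abs:
  fixes P :: "real poly"
  assumes "degree P \<le> n" and "\<And>x. -1 \<le> x \<Longrightarrow> x \<le> 1 \<Longrightarrow> \<bar>poly P x\<bar> \<le> G"
  shows "\<bar>poly (pderiv P) 1\<bar> \<le> (real n)\<^sup>2 * G"
  using pderiv_at_1_bound[of P n G] pderiv_at_1_bound[of "-P" n G] assms
  by (simp add: pderiv_minus abs_le_iff)

text \<open>An affine substitution takes 1 to \<open>x\<close> and -1 to \<open>x - 2 * h\<close>.
  The sign of \<open>h\<close> decides whether \<open>x\<close> is the right or the left end of the
  interval.\<close>

lemma pderiv_endpoint_bound: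
  fixes P :: "real poly"
  assumes deg: "degree P \<le> n" and "h \<noteq> 0"
    and bnd: "\<And>t. -1 \<le> t \<Longrightarrow> t \<le> 1 \<Longrightarrow> \<bar>poly P (x + h * (t - 1))\<bar> \<le> G"
  shows "\<bar>h\<bar> * \<bar>poly (pderiv P) x\<bar> \<le> (real n)\<^sup>2 * G"
proof -
  define R where "R = pcompose P [:x - h, h:]"
  have Rx: "poly R t = poly P (x + h * (t - 1))" for t
    by (simp add: R_def poly_pcompose algebra_simps)
  have "degree R \<le> n" using deg degree_pcompose_le[of P "[:x - h, h:]"]
    by (auto simp: R_def degree_pCons_eq_if split: if_splits)
  then have "\<bar>poly (pderiv R) 1\<bar> \<le> (real n)\<^sup>2 * G"
    by (rule pderiv_at_1_bound_abs) (use bnd Rx in auto)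
  also have "poly (pderiv R) 1 = poly (pderiv P) x * h"
    by (simp add: R_def pderiv_pcompose poly_pcompose pderiv_pCons)
  finally show ?thesis by (simp add: abs_mult mult.commute)
qed

text \<open>A point of an interval is an endpoint of a subinterval of at least half the length,
  so the endpoint bound for the derivative suffices, at the price of a factor 2.\<close>

lemma markov_interval:
  fixes P :: "real poly"
  assumes deg: "degree P \<le> n" and "a < b"
    and bnd: "\<And>t. a \<le> t \<Longrightarrow> t \<le> b \<Longrightarrow> \<bar>poly P t\<bar> \<le> G"
    and x: "a \<le> x" "x \<le> b"
  shows "\<bar>poly (pderiv P) x\<bar> \<le> 4 * (real n)\<^sup>2 * G / (b - a)"
proof -
  \<comment> \<open>Signed so that \<open>x - 2 * h\<close> is the end of \<open>[a, b]\<close>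
    farther from \<open>x\<close>.\<close>
  define h where "h = (if x - a \<ge> b - x then (x - a) / 2 else (x - b) / 2)"
  have h4: "\<bar>h\<bar> \<ge> (b - a) / 4" using assms by (auto simp: h_def)
  have "h \<noteq> 0" using h4 \<open>a < b\<close> by auto
  have "\<bar>h\<bar> * \<bar>poly (pderiv P) x\<bar> \<le> (real n)\<^sup>2 * G"
  proof (rule pderiv_endpoint_bound[OF deg \<open>h \<noteq> 0\<close>])
    fix t :: real assume t: "-1 \<le> t" "t \<le> 1"
    have "a \<le> x + h * (t - 1) \<and> x + h * (t - 1) \<le> b"
    proof (cases "x - a \<ge> b - x")
      case True
      have "(x - a) * (1 - t) \<le> (x - a) * 2" "0 \<le> (x - a) * (1 - t)" 
        using t x by (intro mult_left_mono mult_nonneg_nonneg; simp)+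
      then show ?thesis using True x by (simp add: h_def algebra_simps) argo
    next
      case False
      have "(b - x) * (1 - t) \<le> (b - x) * 2" "0 \<le> (b - x) * (1 - t)" 
        using t x by (intro mult_left_mono mult_nonneg_nonneg; simp)+
      then show ?thesis using False x by (simp add: h_def algebra_simps) argo
    qed
    then show "\<bar>poly P (x + h * (t - 1))\<bar> \<le> G" using bnd by auto
  qed
  moreover have "(b - a) / 4 * \<bar>poly (pderiv P) x\<bar> \<le> \<bar>h\<bar> * \<bar>poly (pderiv P) x\<bar>"
    using h4 by (intro mult_right_mono) auto
  ultimately show ?thesis using \<open>a < b\<close> by (simp add: field_simps)
qed

lemma markov_lipschitz:
  fixes P :: "real poly"
  assumes deg: "degree P \<le> n" and "a < b"
    and bnd: "\<And>t. a \<le> t \<Longrightarrow> t \<le> b \<Longrightarrow> \<bar>poly P t\<bar> \<le> G"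
    and x: "x \<in> {a..b}" and y: "y \<in> {a..b}"
  shows "\<bar>poly P y - poly P x\<bar> \<le> 4 * (real n)\<^sup>2 * G / (b - a) * \<bar>y - x\<bar>"
proof -
  obtain t where t: "t \<in> {a..b}" and eq: "poly P y - poly P x = (y - x) * poly (pderiv P) t"
    using poly_MVT'[of x y "{a..b}" P] x y by auto
  have "\<bar>poly P y - poly P x\<bar> = \<bar>poly (pderiv P) t\<bar> * \<bar>y - x\<bar>"
    by (simp add: eq abs_mult mult.commute)
  also have "\<dots> \<le> 4 * (real n)\<^sup>2 * G / (b - a) * \<bar>y - x\<bar>"
    using markov_interval[OF deg \<open>a < b\<close> bnd] t by (intro mult_right_mono) auto
  finally show ?thesis .
qed

section \<open>Interpolation of window integrals\<close>

definition lagrange :: "nat \<Rightarrow> (nat \<Rightarrow> real) \<Rightarrow> nat \<Rightarrow> real poly" where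
  "lagrange n y k = smult (inverse (\<Prod>m\<in>{..n} - {k}. y k - y m)) (\<Prod>m\<in>{..n} - {k}. [:- y m, 1:])"

lemma poly_lagrange:
  "poly (lagrange n y k) t = (\<Prod>m\<in>{..n} - {k}. t - y m) / (\<Prod>m\<in>{..n} - {k}. y k - y m)"
  by (simp add: lagrange_def poly_prod field_simps)

lemma degree_lagrange: "k \<le> n \<Longrightarrow> degree (lagrange n y k) \<le> n"
proof -
  assume k: "k \<le> n"
  have "degree (\<Prod>m\<in>{..n} - {k}. [:- y m, 1:]) \<le> (\<Sum>m\<in>{..n} - {k}. 1)"
    by (rule order_trans[OF degree_prod_sum_le]) auto
  also have "\<dots> = n" using k by simp
  finally show ?thesis unfolding lagrange_def using degree_smult_le order_trans by blast
qed

lemma lagrange_interpolation: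
  assumes inj: "inj_on y {..n}" and deg: "degree F \<le> n"
  shows "poly F u = (\<Sum>k\<le>n. poly F (y k) * poly (lagrange n y k) u)"
proof -
  define R where "R = (\<Sum>k\<le>n. smult (poly F (y k)) (lagrange n y k))"
  have degR: "degree R \<le> n"
    unfolding R_def
    by (rule degree_sum_le) (auto intro: order_trans[OF degree_smult_le] degree_lagrange)
  have delta: "poly (lagrange n y k) (y m) = (if m = k then 1 else 0)" if "k \<le> n" "m \<le> n" for k m
  proof -
    have "(\<Prod>i\<in>{..n} - {k}. y k - y i) \<noteq> 0"
      using inj that by (auto simp: inj_on_def)
    moreover have "m \<noteq> k \<Longrightarrow> (\<Prod>i\<in>{..n} - {k}. y m - y i) = 0"
      using that by (auto intro!: prod_zero bexI[of _ m])
    ultimately show ?thesis by (auto simp: poly_lagrange)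
  qed
  have "F = R"
  proof (rule poly_eqI_degree)
    show "poly F x = poly R x" if "x \<in> y ` {..n}" for x
    proof -
      obtain m where m: "m \<le> n" "x = y m" using \<open>x \<in> y ` {..n}\<close> by auto
      have "poly R x = (\<Sum>k\<le>n. if k = m then poly F (y k) else 0)"
        unfolding R_def poly_sum using m delta by (intro sum.cong) auto
      then show ?thesis using m by simp
    qed
  qed (use inj deg degR in \<open>auto simp: card_image\<close>)
  from arg_cong[OF this, of "\<lambda>P. poly P u"] show ?thesis by (simp add: R_def poly_sum)
qed

section \<open>Fekete points\<close>

text \<open>Tychonoff's theorem. Confining every coordinate of the sequence keeps the set compact,
  so the Vandermonde product attains its maximum on it.\<close>

lemma compact_Pi_interval: "compact {y :: nat \<Rightarrow> real. \<forall>k. y k \<in> {a..b}}"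
proof -
  have "{y :: nat \<Rightarrow> real. \<forall>k. y k \<in> {a..b}} = PiE UNIV (\<lambda>_. {a..b})"
    by (auto simp: PiE_def)
  moreover have "compactin (product_topology (\<lambda>_. euclidean) UNIV) (PiE UNIV (\<lambda>_::nat. {a..b}))"
    by (subst compactin_PiE) auto
  ultimately show ?thesis by (simp add: euclidean_product_topology)
qed

text \<open>Fekete points: nodes maximising the Vandermonde product. Moving one node changes that
  product exactly by the factor \<open>(lagrange n y k t)\<^sup>2\<close>.\<close>

lemma fekete_points:
  fixes a b :: real
  assumes "a < b"
  obtains y where "inj_on y {..n}" "\<And>k. y k \<in> {a..b}"
    "\<And>k t. \<lbrakk>k \<le> n; t \<in> {a..b}\<rbrakk> \<Longrightarrow> \<bar>poly (lagrange n y k) t\<bar> \<le> 1"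
proof -
  define K where "K = {y :: nat \<Rightarrow> real. \<forall>k. y k \<in> {a..b}}"
  define V where "V y = (\<Prod>i\<le>n. \<Prod>j\<in>{..n} - {i}. \<bar>y i - y j\<bar>)" for y :: "nat \<Rightarrow> real"
  have "continuous_on K V"
    unfolding V_def by (intro continuous_intros continuous_on_product_then_coordinatewise continuous_on_id)
  moreover have "(\<lambda>_. a) \<in> K" using assms by (auto simp: K_def)
  ultimately obtain y where y: "y \<in> K" and max: "\<And>z. z \<in> K \<Longrightarrow> V z \<le> V y"
    using continuous_attains_sup[of K V] compact_Pi_interval[of a b] unfolding K_def[symmetric] by blast
  \<comment> \<open>Some sequence of distinct points of the interval, to show that the maximum is
    positive.\<close>
  define z where "z k = a + (b - a) / (real k + 1)" for k
  have "z \<in> K" using assms by (auto simp: K_def z_def field_simps intro: mult_right_mono)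
  moreover have "V z > 0"
    using assms by (auto simp: V_def z_def intro!: prod_pos)
  ultimately have Vy: "V y > 0" using max by force
  have inj: "inj_on y {..n}"
  proof (rule inj_onI, rule ccontr)
    fix i j assume "i \<in> {..n}" "j \<in> {..n}" "y i = y j" "i \<noteq> j"
    then have "(\<Prod>j\<in>{..n} - {i}. \<bar>y i - y j\<bar>) = 0"
      using \<open>j \<in> {..n}\<close> \<open>y i = y j\<close> \<open>i \<noteq> j\<close> by (subst prod_zero_iff) auto
    then have "V y = 0" unfolding V_def
      using \<open>i \<in> {..n}\<close> by (subst prod_zero_iff) auto
    then show False using Vy by simp
  qed
  have "\<bar>poly (lagrange n y k) t\<bar> \<le> 1" if k: "k \<le> n" and t: "t \<in> {a..b}" for k t
  proof -
    define A where "A x = (\<Prod>j\<in>{..n} - {k}. \<bar>x - y j\<bar>)" for x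
    define B where "B = (\<Prod>i\<in>{..n} - {k}. \<Prod>j\<in>{..n} - {k} - {i}. \<bar>y i - y j\<bar>)"
    \<comment> \<open>Each pair of nodes occurs in \<open>V\<close> in both orders, whence the
      square; \<open>B\<close> collects the pairs that avoid node \<open>k\<close>.\<close>
    have V: "V (y(k := x)) = (A x)\<^sup>2 * B" for x
    proof -
      let ?y = "y(k := x)"
      have "V ?y = (\<Prod>j\<in>{..n} - {k}. \<bar>?y k - ?y j\<bar>)
          * (\<Prod>i\<in>{..n} - {k}. \<Prod>j\<in>{..n} - {i}. \<bar>?y i - ?y j\<bar>)"
        unfolding V_def using k by (subst prod.remove[of _ k]) auto
      also have "(\<Prod>i\<in>{..n} - {k}. \<Prod>j\<in>{..n} - {i}. \<bar>?y i - ?y j\<bar>)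
          = (\<Prod>i\<in>{..n} - {k}. \<bar>y i - x\<bar> * (\<Prod>j\<in>{..n} - {k} - {i}. \<bar>y i - y j\<bar>))"
      proof (rule prod.cong)
        fix i assume i: "i \<in> {..n} - {k}"
        have "{..n} - {i} - {k} = {..n} - {k} - {i}" by auto
        then show "(\<Prod>j\<in>{..n} - {i}. \<bar>?y i - ?y j\<bar>)
            = \<bar>y i - x\<bar> * (\<Prod>j\<in>{..n} - {k} - {i}. \<bar>y i - y j\<bar>)"
          using i k by (subst prod.remove[of _ k]) auto
      qed simp
      also have "\<dots> = A x * B"
        by (simp add: prod.distrib A_def B_def abs_minus_commute)
      also have "(\<Prod>j\<in>{..n} - {k}. \<bar>?y k - ?y j\<bar>) = A x"
        unfolding A_def by (intro prod.cong) auto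
      finally show ?thesis by (simp only: power2_eq_square mult.assoc)
    qed
    have B0: "B \<ge> 0" unfolding B_def by (intro prod_nonneg) auto
    have A0: "A x \<ge> 0" for x unfolding A_def by (intro prod_nonneg) auto
    have Vk: "V y = (A (y k))\<^sup>2 * B" using V[of "y k"] by simp
    then have "B > 0" using Vy B0 by (cases "B = 0") auto
    have Ayk: "A (y k) > 0" using Vk Vy A0[of "y k"] by (cases "A (y k) = 0") auto
    have "y(k := t) \<in> K" using y t by (auto simp: K_def)
    from max[OF this] have "(A t)\<^sup>2 * B \<le> (A (y k))\<^sup>2 * B" by (simp add: V Vk)
    then have "(A t)\<^sup>2 \<le> (A (y k))\<^sup>2" using \<open>B > 0\<close> by simp
    then have "A t \<le> A (y k)" using A0 power2_le_imp_le by blast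
    then show ?thesis using Ayk
      by (simp add: poly_lagrange abs_prod A_def divide_simps)
  qed
  with that[of y] inj y show ?thesis by (auto simp: K_def)
qed

section \<open>Forward differences and window integrals\<close>

definition forward_diff :: "real \<Rightarrow> real poly \<Rightarrow> real poly" where
  "forward_diff w P = pcompose P [:w, 1:] - P"

lemma forward_diff_add: "forward_diff w (P + Q) = forward_diff w P + forward_diff w Q"
  by (simp add: forward_diff_def pcompose_add)

text \<open>The binomial theorem; the leading terms cancel, so the degree drops by one.\<close>

lemma coeff_forward_diff_monom:
  "coeff (forward_diff w (monom c (Suc n))) i =
     (if i \<le> n then c * real (Suc n choose i) * w ^ (Suc n - i) else 0)"
proof -
  have eq: "pcompose (monom c (Suc n)) [:w, 1:] = smult c ([:w, 1:] ^ Suc n)"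
    by (rule poly_ext) (simp add: poly_pcompose poly_monom del: power_Suc)
  consider "i \<le> n" | "i = Suc n" | "i > Suc n" by linarith
  then show ?thesis
  proof cases
    case 3
    then have "coeff ([:w, 1:] ^ Suc n) i = 0"
      by (intro coeff_eq_0) (metis degree_linear_power)
    then show ?thesis using 3 by (simp add: forward_diff_def eq del: power_Suc)
  qed (auto simp add: forward_diff_def eq coeff_linear_poly_power simp del: power_Suc)
qed

text \<open>Induction on the degree: subtract the forward difference of a monomial that matches the
  leading coefficient of \<open>L\<close>.\<close>

lemma forward_diff_onto:
  assumes "w \<noteq> 0" "degree L \<le> n"
  shows "\<exists>E. degree E \<le> Suc n \<and> forward_diff w E = L"
  using assms(2)
proof (induction n arbitrary: L)
  case 0
  then obtain c where "L = [:c:]" using degree_eq_zeroE by blast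
  then show ?case using assms(1)
    by (intro exI[of _ "[:0, c / w:]"]) (auto simp: forward_diff_def pcompose_pCons)
next
  case (Suc n)
  \<comment> \<open>The forward difference of the monomial of degree \<open>n + 2\<close> has
    leading coefficient \<open>(n + 2) * w\<close>.\<close>
  define M where "M = monom (coeff L (Suc n) / (real (n + 2) * w)) (Suc (Suc n))"
  have "degree (L - forward_diff w M) \<le> n"
  proof (rule degree_le, intro allI impI)
    fix i assume i: "n < i"
    show "coeff (L - forward_diff w M) i = 0"
    proof (cases "i = Suc n")
      case True
      then show ?thesis
        using assms(1) by (simp add: M_def coeff_forward_diff_monom)
    next
      case False
      then show ?thesis
        using i Suc.prems by (auto simp: M_def coeff_forward_diff_monom intro!: coeff_eq_0)
    qed
  qed
  then obtain E where "degree E \<le> Suc n" "forward_diff w E = L - forward_diff w M"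
    using Suc.IH by blast
  moreover have "degree M \<le> Suc (Suc n)" by (simp add: M_def degree_monom_le)
  ultimately show ?case
    by (intro exI[of _ "E + M"]) (auto simp: forward_diff_add intro: degree_add_le)
qed

lemma degree_forward_diff:
  assumes "degree E \<le> Suc n"
  shows "degree (forward_diff w E) \<le> n"
proof -
  have E: "E = (\<Sum>i\<le>Suc n. monom (coeff E i) i)"
    using assms poly_as_sum_of_monoms' by metis
  have sum: "forward_diff w (sum f A) = (\<Sum>i\<in>A. forward_diff w (f i))" if "finite A" for f and A :: "nat set"
    using that by induction (simp_all add: forward_diff_add, simp add: forward_diff_def)
  show ?thesis
    apply (subst E)
    apply (subst sum, simp)
  proof (rule degree_sum_le, simp)
    fix i assume "i \<in> {..Suc n}"
    show "degree (forward_diff w (monom (coeff E i) i)) \<le> n"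
    proof (cases i)
      case 0
      then show ?thesis by (simp add: forward_diff_def monom_0)
    next
      case (Suc m)
      then show ?thesis using \<open>i \<in> {..Suc n}\<close>
        by (intro degree_le) (auto simp: coeff_forward_diff_monom)
    qed
  qed
qed

lemma antiderivative_poly:
  fixes P :: "real poly"
  obtains E where "pderiv E = P" "degree E \<le> Suc (degree P)"
proof -
  define E where "E = (\<Sum>i\<le>degree P. monom (coeff P i / real (Suc i)) (Suc i))"
  have "pderiv E = (\<Sum>i\<le>degree P. monom (coeff P i) i)"
  proof -
    have "pderiv (sum f A) = (\<Sum>i\<in>A. pderiv (f i))" for f :: "nat \<Rightarrow> real poly" and A
      by (induction A rule: infinite_finite_induct) (simp_all add: pderiv_add)
    then show ?thesis
      unfolding E_def by (auto simp: pderiv_monom intro!: sum.cong)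
  qed
  also have "\<dots> = P" by (rule poly_as_sum_of_monoms)
  finally show ?thesis
    by (rule that) (auto simp: E_def intro!: degree_sum_le order_trans[OF degree_monom_le])
qed

lemma set_integrable_poly: "set_integrable lborel {a<..<b} (poly P)" for a b :: real
  by (rule set_integrable_subset[where A="{a..b}"], rule borel_integrable_atLeastAtMost') (auto intro: continuous_intros)

lemma integral_pderiv:
  fixes a b :: real
  assumes "a \<le> b"
  shows "(LINT t:{a<..<b}|lborel. poly (pderiv E) t) = poly E b - poly E a"
proof -
  have [measurable]: "poly (pderiv E) \<in> borel_measurable borel"
    by (intro borel_measurable_continuous_onI continuous_intros)
  have "(LINT t:{a<..<b}|lborel. poly (pderiv E) t) = (LINT t:{a..b}|lborel. poly (pderiv E) t)"
  proof (rule set_integral_cong_set)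
    show "AE x in lborel. (x \<in> {a..b}) = (x \<in> {a<..<b})"
      using AE_lborel_singleton[of a] AE_lborel_singleton[of b] by eventually_elim auto
  qed (simp_all add: set_borel_measurable_def)
  also have "\<dots> = (\<integral>t. poly (pderiv E) t * indicator {a..b} t \<partial>lborel)"
    by (simp add: set_lebesgue_integral_def mult.commute)
  also have "\<dots> = poly E b - poly E a"
    by (rule integral_FTC_Icc_real) (use assms in \<open>auto intro: poly_DERIV\<close>)
  finally show ?thesis .
qed

text \<open>The integral is a forward difference of an antiderivative: integration raises the degree
  by one and the difference lowers it again.\<close>

lemma window_integral_poly:
  fixes P :: "real poly"
  assumes "w \<ge> 0"
  obtains F where "degree F \<le> degree P" "\<And>u. (LINT t:{u<..<u + w}|lborel. poly P t) = poly F u"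
proof -
  obtain E where E: "pderiv E = P" "degree E \<le> Suc (degree P)" by (rule antiderivative_poly)
  show ?thesis
  proof (rule that[of "forward_diff w E"])
    show "(LINT t:{u<..<u + w}|lborel. poly P t) = poly (forward_diff w E) u" for u
      using integral_pderiv[of u "u + w" E] assms E
      by (simp add: forward_diff_def poly_pcompose add.commute)
  qed (rule degree_forward_diff[OF E(2)])
qed

text \<open>The converse of the preceding lemma, from surjectivity of the forward difference. It
  turns interpolated window integrals back into integrals of an actual polynomial.\<close>

lemma window_integral_poly_onto:
  fixes L :: "real poly"
  assumes "w > 0" "degree L \<le> n"
  obtains e where "degree e \<le> n" "\<And>u. (LINT t:{u<..<u + w}|lborel. poly e t) = poly L u"
proof -
  obtain E where E: "degree E \<le> Suc n" "forward_diff w E = L"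
    using forward_diff_onto[of w L n] assms by auto
  show ?thesis
  proof (rule that[of "pderiv E"])
    show "(LINT t:{u<..<u + w}|lborel. poly (pderiv E) t) = poly L u" for u
      using integral_pderiv[of u "u + w" E] assms E(2)
      by (auto simp: forward_diff_def poly_pcompose add.commute)
  qed (use E in \<open>auto simp: degree_pderiv\<close>)
qed

text \<open>Recovering polynomials of degree at most \<open>n\<close> on \<open>[a, a + l]\<close> from the integrals over the
  \<open>n + 1\<close> windows with left ends \<open>y k\<close> and length \<open>w\<close>; the polynomial \<open>e k\<close> is dual to the
  \<open>k\<close>-th window and \<open>L k\<close> is its window integral.\<close>

definition window_system ::
  "nat \<Rightarrow> real \<Rightarrow> real \<Rightarrow> real \<Rightarrow> (nat \<Rightarrow> real) \<Rightarrow> (nat \<Rightarrow> real poly) \<Rightarrow> (nat \<Rightarrow> real poly) \<Rightarrow> bool"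
  where "window_system n a l w y L e \<longleftrightarrow>
    (\<forall>k\<le>n. a \<le> y k \<and> y k + w \<le> a + l) \<and>
    (\<forall>k\<le>n. degree (e k) \<le> n) \<and>
    (\<forall>k\<le>n. \<forall>u. (LINT t:{u<..<u + w}|lborel. poly (e k) t) = poly (L k) u) \<and>
    (\<forall>k\<le>n. \<forall>u. a \<le> u \<longrightarrow> u + w \<le> a + l \<longrightarrow> \<bar>poly (L k) u\<bar> \<le> 1) \<and>
    (\<forall>P u. degree P \<le> n \<longrightarrow> (LINT t:{u<..<u + w}|lborel. poly P t) =
       (\<Sum>k\<le>n. poly (L k) u * (LINT t:{y k<..<y k + w}|lborel. poly P t)))"

lemmas window_systemD =
  window_system_def[THEN iffD1, THEN conjunct1, rule_format]
  window_system_def[THEN iffD1, THEN conjunct2, THEN conjunct1, rule_format]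
  window_system_def[THEN iffD1, THEN conjunct2, THEN conjunct2, THEN conjunct1, rule_format]
  window_system_def[THEN iffD1, THEN conjunct2, THEN conjunct2, THEN conjunct2, THEN conjunct1, rule_format]
  window_system_def[THEN iffD1, THEN conjunct2, THEN conjunct2, THEN conjunct2, THEN conjunct2, rule_format]

text \<open>The nodes are Fekete points of the interval of admissible left ends. Lagrange
  interpolation in the left end is exact because the window integral of \<open>P\<close> is a
  polynomial in it of degree at most \<open>n\<close>.\<close>

lemma window_system_exists:
  fixes a l w :: real
  assumes "0 < w" "w < l"
  shows "\<exists>y L e. window_system n a l w y L e"
proof -
  obtain y where y: "inj_on y {..n}" "\<And>k. y k \<in> {a..a + l - w}"
    "\<And>k t. \<lbrakk>k \<le> n; t \<in> {a..a + l - w}\<rbrakk> \<Longrightarrow> \<bar>poly (lagrange n y k) t\<bar> \<le> 1"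
    using fekete_points[of a "a + l - w"] assms by auto
  have "\<exists>e. degree e \<le> n \<and> (\<forall>u. (LINT t:{u<..<u + w}|lborel. poly e t) = poly (lagrange n y k) u)"
    if "k \<le> n" for k
    using window_integral_poly_onto[OF assms(1) degree_lagrange[OF that]] by metis
  then obtain e where e: "\<And>k. k \<le> n \<Longrightarrow> degree (e k) \<le> n \<and>
      (\<forall>u. (LINT t:{u<..<u + w}|lborel. poly (e k) t) = poly (lagrange n y k) u)"
    by metis
  have "window_system n a l w y (lagrange n y) e"
    unfolding window_system_def
  proof (intro conjI allI impI)
    fix P :: "real poly" and u assume "degree P \<le> n"
    obtain F where "degree F \<le> degree P" and F: "\<And>u. (LINT t:{u<..<u + w}|lborel. poly P t) = poly F u"
      using window_integral_poly[of w P] assms by auto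
    then show "(LINT t:{u<..<u + w}|lborel. poly P t) =
       (\<Sum>k\<le>n. poly (lagrange n y k) u * (LINT t:{y k<..<y k + w}|lborel. poly P t))"
      using lagrange_interpolation[OF y(1), of F u] \<open>degree P \<le> n\<close> by (simp add: F mult.commute)
  next
    fix k u assume "k \<le> n" "a \<le> u" "u + w \<le> a + l"
    then show "\<bar>poly (lagrange n y k) u\<bar> \<le> 1" by (intro y(3)) auto
  next
    fix k show "a \<le> y k" "y k + w \<le> a + l" using y(2)[of k] by auto
  qed (use e in auto)
  then show ?thesis by blast
qed

section \<open>Coordinatewise polynomials\<close>

text \<open>Fixing all coordinates but one is the form in which the one-variable Markov inequality
  applies. Real coefficients leave room for the interpolant of \<open>m_dir_interpolant\<close>;
  continuity provides maxima on boxes and integrability.\<close>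

definition coord_polys :: "nat^'d \<Rightarrow> (real^'d \<Rightarrow> real) set" where
  "coord_polys r = {g. continuous_on UNIV g \<and>
     (\<forall>x i. \<exists>P. degree P \<le> r $ i \<and> (\<forall>t. g (\<chi> l. if l = i then t else x $ l) = poly P t))}"

lemma coord_polysD:
  assumes "g \<in> coord_polys r"
  shows "continuous_on A g"
    and "\<exists>P. degree P \<le> r $ i \<and> (\<forall>t. g (\<chi> l. if l = i then t else x $ l) = poly P t)"
  using assms continuous_on_subset by (auto simp: coord_polys_def)

lemma coord_polys_add:
  assumes "f \<in> coord_polys r" "g \<in> coord_polys r"
  shows "(\<lambda>x. f x + g x) \<in> coord_polys r"
  unfolding coord_polys_def
proof (intro CollectI conjI allI)
  fix x i
  obtain P Q where "degree P \<le> r $ i" "\<forall>t. f (\<chi> l. if l = i then t else x $ l) = poly P t"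
    "degree Q \<le> r $ i" "\<forall>t. g (\<chi> l. if l = i then t else x $ l) = poly Q t"
    using assms[THEN coord_polysD(2)] by metis
  then show "\<exists>P. degree P \<le> r $ i \<and> (\<forall>t. f (\<chi> l. if l = i then t else x $ l)
      + g (\<chi> l. if l = i then t else x $ l) = poly P t)"
    by (intro exI[of _ "P + Q"]) (auto intro: degree_add_le)
qed (intro continuous_intros coord_polysD(1)[OF assms(1)] coord_polysD(1)[OF assms(2)])

lemma coord_polys_cmult:
  assumes "f \<in> coord_polys r"
  shows "(\<lambda>x. c * f x) \<in> coord_polys r"
  unfolding coord_polys_def
proof (intro CollectI conjI allI)
  fix x i
  obtain P where "degree P \<le> r $ i" "\<forall>t. f (\<chi> l. if l = i then t else x $ l) = poly P t"
    using assms[THEN coord_polysD(2)] by metis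
  then show "\<exists>P. degree P \<le> r $ i \<and> (\<forall>t. c * f (\<chi> l. if l = i then t else x $ l) = poly P t)"
    by (intro exI[of _ "smult c P"]) (auto intro: order_trans[OF degree_smult_le])
qed (intro continuous_intros coord_polysD(1)[OF assms])

lemma coord_polys_diff:
  assumes "f \<in> coord_polys r" "g \<in> coord_polys r"
  shows "(\<lambda>x. f x - g x) \<in> coord_polys r"
  using coord_polys_add[OF assms(1) coord_polys_cmult[OF assms(2), of "-1"]] by simp

lemma coord_polys_zero: "(\<lambda>_. 0) \<in> coord_polys r"
  by (auto simp: coord_polys_def intro!: exI[of _ 0])

lemma coord_polys_prod:
  fixes r :: "nat^'d"
  assumes "\<And>i. degree (P i) \<le> r $ i"
  shows "(\<lambda>x. \<Prod>i\<in>UNIV. poly (P i) (x $ i)) \<in> coord_polys r"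
  unfolding coord_polys_def
proof (intro CollectI conjI allI)
  fix x :: "real^'d" and i
  show "\<exists>Q. degree Q \<le> r $ i \<and>
    (\<forall>t. (\<Prod>k\<in>UNIV. poly (P k) ((\<chi> l. if l = i then t else x $ l) $ k)) = poly Q t)"
  proof (intro exI[of _ "smult (\<Prod>k\<in>UNIV - {i}. poly (P k) (x $ k)) (P i)"] conjI allI)
    fix t
    show "(\<Prod>k\<in>UNIV. poly (P k) ((\<chi> l. if l = i then t else x $ l) $ k))
        = poly (smult (\<Prod>k\<in>UNIV - {i}. poly (P k) (x $ k)) (P i)) t"
      by (subst prod.remove[of _ i]) (auto simp: mult.commute intro!: prod.cong)
  qed (use assms order_trans[OF degree_smult_le] in blast)
qed (intro continuous_intros)

lemma set_integrable_coord_poly: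
  assumes "g \<in> coord_polys r"
  shows "set_integrable lborel (box u v) g"
proof (rule set_integrable_subset)
  show "set_integrable lborel (cbox u v) g"
    unfolding set_integrable_def
    by (intro borel_integrable_compact coord_polysD(1)[OF assms] compact_cbox)
qed (auto intro: box_subset_cbox[THEN subsetD])

text \<open>Move from \<open>x\<close> to \<open>y\<close> one coordinate of \<open>F\<close> at a
  time; each move stays in the box and costs one application of
  \<open>markov_lipschitz\<close>.\<close>

lemma coord_poly_oscillation:
  assumes g: "g \<in> coord_polys r" and l: "\<And>i. l $ i > 0" and F: "finite F"
    and bnd: "\<And>z. z \<in> cbox a (a + l) \<Longrightarrow> \<bar>g z\<bar> \<le> G"
    and x: "x \<in> cbox a (a + l)" and y: "y \<in> cbox a (a + l)"
    and near: "\<And>i. \<bar>y $ i - x $ i\<bar> \<le> \<delta> * l $ i"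
  shows "\<bar>g (\<chi> i. if i \<in> F then y $ i else x $ i) - g x\<bar> \<le> 4 * G * \<delta> * (\<Sum>i\<in>F. (real (r $ i))\<^sup>2)"
  using F
proof induction
  case empty
  then show ?case by simp
next
  case (insert i F)
  define z where "z = (\<chi> l. if l \<in> F then y $ l else x $ l)"
  obtain P where P: "degree P \<le> r $ i" "\<And>t. g (\<chi> l. if l = i then t else z $ l) = poly P t"
    using coord_polysD(2)[OF g] by metis
  have G0: "G \<ge> 0" using bnd[OF x] by linarith
  have "\<bar>poly P (y $ i) - poly P (x $ i)\<bar>
      \<le> 4 * (real (r $ i))\<^sup>2 * G / ((a $ i + l $ i) - a $ i) * \<bar>y $ i - x $ i\<bar>"
  proof (rule markov_lipschitz[OF P(1)])
    fix t assume "a $ i \<le> t" "t \<le> a $ i + l $ i"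
    then have "(\<chi> l. if l = i then t else z $ l) \<in> cbox a (a + l)"
      using x y by (auto simp: mem_box_cart z_def)
    then show "\<bar>poly P t\<bar> \<le> G" using bnd P(2) by metis
  qed (use l x y in \<open>auto simp: mem_box_cart\<close>)
  also have "\<dots> \<le> 4 * (real (r $ i))\<^sup>2 * G / l $ i * (\<delta> * l $ i)"
    using l[of i] G0 near[of i] by (intro mult_mono) auto
  also have "\<dots> = 4 * G * \<delta> * (real (r $ i))\<^sup>2"
    using l[of i] by (simp add: field_simps)
  finally have "\<bar>poly P (y $ i) - poly P (x $ i)\<bar> \<le> 4 * G * \<delta> * (real (r $ i))\<^sup>2" .
  moreover have "poly P (y $ i) = g (\<chi> l. if l \<in> insert i F then y $ l else x $ l)"
    unfolding P(2)[symmetric] by (rule arg_cong[of _ _ g]) (auto simp: vec_eq_iff z_def)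
  moreover have "poly P (x $ i) = g z"
    unfolding P(2)[symmetric] using insert.hyps(2)
    by (intro arg_cong[of _ _ g]) (auto simp: vec_eq_iff z_def)
  ultimately show ?case
    using insert unfolding z_def by (simp add: algebra_simps)
qed

text \<open>Around a maximum point of \<open>\<bar>g\<bar>\<close> there is a subbox of relative side length \<open>\<delta>\<close>
  on which \<open>g\<close> keeps half of its size, so its mean there is large.\<close>

lemma sup_le_of_averages:
  fixes a l :: "real^'d"
  assumes g: "g \<in> coord_polys r" and l: "\<And>i. l $ i > 0"
    and \<delta>: "0 < \<delta>" "\<delta> \<le> 1 / 2" "8 * \<delta> * (\<Sum>i\<in>UNIV. (real (r $ i))\<^sup>2) \<le> 1"
    and avg: "\<And>u. (\<And>i. a $ i \<le> u $ i \<and> u $ i + \<delta> * l $ i \<le> a $ i + l $ i) \<Longrightarrow>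
      \<bar>LINT x:box u (u + \<delta> *\<^sub>R l)|lborel. g x\<bar> \<le> K * measure lborel (box u (u + \<delta> *\<^sub>R l))"
    and x: "x \<in> cbox a (a + l)"
  shows "\<bar>g x\<bar> \<le> 2 * K"
proof -
  obtain x0 where x0: "x0 \<in> cbox a (a + l)" and max: "\<And>z. z \<in> cbox a (a + l) \<Longrightarrow> \<bar>g z\<bar> \<le> \<bar>g x0\<bar>"
    using continuous_attains_sup[of "cbox a (a + l)" "\<lambda>x. \<bar>g x\<bar>"] coord_polysD(1)[OF g] x
      compact_cbox continuous_on_rabs by blast
  define G where "G = \<bar>g x0\<bar>"
  \<comment> \<open>The subbox has \<open>x0\<close> as a corner and extends in each direction
    towards the farther face, so it stays inside the cell.\<close>
  define u where "u = (\<chi> i. if x0 $ i \<le> a $ i + l $ i / 2 then x0 $ i else x0 $ i - \<delta> * l $ i)"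
  let ?B = "box u (u + \<delta> *\<^sub>R l)"
  have dl: "0 < \<delta> * l $ i" "\<delta> * l $ i \<le> l $ i / 2" for i
    using \<delta>(1,2) l[of i] mult_right_mono[OF \<delta>(2), of "l $ i"] by auto
  have ub: "a $ i \<le> u $ i \<and> u $ i + \<delta> * l $ i \<le> a $ i + l $ i" for i
    using x0 dl[of i] by (auto simp: u_def mem_box_cart)
  have osc: "\<bar>g y - g x0\<bar> \<le> G / 2" if y: "y \<in> ?B" for y
  proof -
    have "u $ i < y $ i" "y $ i < u $ i + \<delta> * l $ i" for i
      using y by (auto simp: mem_box_cart)
    then have "y \<in> cbox a (a + l)" "\<bar>y $ i - x0 $ i\<bar> \<le> \<delta> * l $ i" for i
      using ub dl(1)[of i] by (auto simp: mem_box_cart u_def intro: order_trans less_imp_le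
          split: if_splits) (smt (verit, best))+
    then have "\<bar>g (\<chi> i. if i \<in> UNIV then y $ i else x0 $ i) - g x0\<bar>
        \<le> 4 * G * \<delta> * (\<Sum>i\<in>UNIV. (real (r $ i))\<^sup>2)"
      using max by (intro coord_poly_oscillation[OF g l _ _ x0]) (auto simp: G_def)
    also have "\<dots> = G / 2 * (8 * \<delta> * (\<Sum>i\<in>UNIV. (real (r $ i))\<^sup>2))" by simp
    also have "\<dots> \<le> G / 2 * 1" using \<delta>(3) by (intro mult_left_mono) (auto simp: G_def)
    finally show ?thesis by simp
  qed
  have fin: "emeasure lborel ?B \<noteq> \<infinity>"
    using emeasure_lborel_box_finite[of u] by (metis infinity_ennreal_def less_irrefl)
  have pos: "0 < measure lborel ?B"
    using dl by (subst measure_lborel_box_eq) (auto simp: Basis_vec_def inner_axis intro!: prod_pos less_imp_le)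
  have "G / 2 * measure lborel ?B = (LINT y:?B|lborel. G / 2)"
    using fin by (simp add: set_integral_const)
  \<comment> \<open>By \<open>osc\<close> the values of \<open>g\<close> stay within
    \<open>G / 2\<close> of \<open>g x0\<close>, so after multiplication by the sign of
    \<open>g x0\<close> the integrand is at least \<open>G / 2\<close>.\<close>
  also have "\<dots> \<le> (LINT y:?B|lborel. sgn (g x0) * g y)"
  proof (rule set_integral_mono)
    show "set_integrable lborel ?B (\<lambda>y. G / 2)"
      using coord_polys_cmult[OF coord_polys_prod[where P="\<lambda>_. 1" and r=r], of "G / 2"]
      by (intro set_integrable_coord_poly[of _ r]) auto
    show "set_integrable lborel ?B (\<lambda>y. sgn (g x0) * g y)"
      by (intro set_integrable_mult_right set_integrable_coord_poly[OF g])
    show "G / 2 \<le> sgn (g x0) * g y" if "y \<in> ?B" for y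
      using osc[OF that] by (auto simp: G_def sgn_if abs_if split: if_splits)
  qed
  also have "\<dots> = sgn (g x0) * (LINT y:?B|lborel. g y)" by simp
  also have "\<dots> \<le> \<bar>LINT y:?B|lborel. g y\<bar>" by (auto simp: sgn_if)
  also have "\<dots> \<le> K * measure lborel ?B" by (rule avg[OF ub])
  finally have "G / 2 \<le> K" using pos by simp
  then show ?thesis using max[OF x] by (simp add: G_def)
qed

section \<open>Product integrals and dyadic cells\<close>

lemma Basis_cart_real: "(Basis :: (real^'d) set) = range (\<lambda>i. axis i 1)"
  by (auto simp: Basis_vec_def)

lemma prod_Basis_cart: "(\<Prod>b\<in>(Basis :: (real^'d) set). f b) = (\<Prod>i\<in>UNIV. f (axis i 1))"
  unfolding Basis_cart_real
  by (subst prod.reindex) (auto simp: inj_on_def axis_eq_axis)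

lemma measure_box_cart:
  fixes u w :: "real^'d"
  assumes "\<And>i. 0 \<le> w $ i"
  shows "measure lborel (box u (u + w)) = (\<Prod>i\<in>UNIV. w $ i)"
  using assms by (subst measure_lborel_box_eq) (simp add: prod_Basis_cart inner_axis, auto simp: Basis_cart_real inner_axis)

text \<open>Lebesgue measure is the image of the product measure indexed by the standard basis, so
  the product rule for integrals applies once the factors are reindexed by basis vectors
  (\<open>H\<close>).\<close>

lemma lborel_integral_prod_cart:
  fixes G :: "'d::finite \<Rightarrow> real \<Rightarrow> real"
  assumes int: "\<And>i. integrable lborel (G i)"
  shows "integrable lborel (\<lambda>x::real^'d. \<Prod>i\<in>UNIV. G i (x $ i))"
    and "(LINT x|lborel. (\<Prod>i\<in>UNIV. G i ((x::real^'d) $ i))) = (\<Prod>i\<in>UNIV. (LINT t|lborel. G i t))"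
proof -
  interpret product_sigma_finite "\<lambda>_::real^'d. lborel :: real measure" ..
  define H where "H b = G (THE i. b = axis i 1)" for b :: "real^'d"
  have Haxis: "H (axis i 1) = G i" for i
    unfolding H_def by (rule arg_cong[of _ _ G]) (auto simp: axis_eq_axis)
  have intH: "integrable lborel (H b)" if "b \<in> Basis" for b
    using that int by (auto simp: Basis_cart_real Haxis)
  have [measurable]: "G i \<in> borel_measurable borel" for i
    using borel_measurable_integrable[OF int] by simp
  have [measurable]: "(\<lambda>x::real^'d. \<Prod>i\<in>UNIV. G i (x $ i)) \<in> borel_measurable borel"
    by (intro borel_measurable_prod measurable_compose[OF borel_measurable_nth]) auto
  let ?\<phi> = "\<lambda>f. \<Sum>b\<in>Basis. f b *\<^sub>R (b :: real^'d)"
  have [measurable]: "?\<phi> \<in> (\<Pi>\<^sub>M b\<in>Basis. lborel) \<rightarrow>\<^sub>M borel"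
    by simp
  have eq: "(\<Prod>i\<in>UNIV. G i (?\<phi> f $ i)) = (\<Prod>b\<in>Basis. H b (f b))" for f :: "real^'d \<Rightarrow> real"
  proof -
    have "?\<phi> f $ i = f (axis i 1)" for i
      using inner_sum_left_Basis[of "axis i 1" f] by (simp add: Basis_cart_real inner_axis)
    then show ?thesis by (simp add: prod_Basis_cart Haxis)
  qed
  show "integrable lborel (\<lambda>x::real^'d. \<Prod>i\<in>UNIV. G i (x $ i))"
    by (subst lborel_eq, subst integrable_distr_eq, simp, simp, unfold eq,
        intro product_integrable_prod intH) auto
  have "(LINT x|lborel. (\<Prod>i\<in>UNIV. G i ((x::real^'d) $ i)))
      = (LINT f|(\<Pi>\<^sub>M b\<in>(Basis :: (real^'d) set). lborel). (\<Prod>b\<in>Basis. H b (f b)))"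
    by (subst lborel_eq, subst integral_distr, simp, simp, unfold eq) (rule refl)
  also have "\<dots> = (\<Prod>b\<in>Basis. (LINT t|lborel. H b t))"
    by (intro product_integral_prod intH) auto
  finally show "(LINT x|lborel. (\<Prod>i\<in>UNIV. G i ((x::real^'d) $ i))) = (\<Prod>i\<in>UNIV. (LINT t|lborel. G i t))"
    by (simp add: prod_Basis_cart Haxis)
qed

lemma box_integral_prod:
  fixes G :: "'d::finite \<Rightarrow> real \<Rightarrow> real" and u w :: "real^'d"
  assumes "\<And>i. set_integrable lborel {u $ i<..<u $ i + w $ i} (G i)"
  shows "(LINT x:box u (u + w)|lborel. (\<Prod>i\<in>UNIV. G i (x $ i)))
    = (\<Prod>i\<in>UNIV. (LINT t:{u $ i<..<u $ i + w $ i}|lborel. G i t))"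
proof -
  have ind: "indicator (box u (u + w)) x
      = (\<Prod>i\<in>UNIV. indicator {u $ i<..<u $ i + w $ i} (x $ i) :: real)" for x
    by (auto simp: indicator_def mem_box_cart prod_zero_iff)
  show ?thesis
    using lborel_integral_prod_cart(2)[of "\<lambda>i t. indicator {u $ i<..<u $ i + w $ i} t * G i t"] assms
    by (simp add: set_lebesgue_integral_def set_integrable_def ind prod.distrib)
qed

section \<open>Dyadic intervals and cells\<close>

definition dyadic_interval :: "int \<Rightarrow> int \<Rightarrow> real set" where
  "dyadic_interval J n = {of_int n * 2 powi (- J) ..< (of_int n + 1) * 2 powi (- J)}"

definition dyadic_cell :: "int^'d \<Rightarrow> int^'d \<Rightarrow> (real^'d) set" where
  "dyadic_cell j n = {x. \<forall>i. x $ i \<in> dyadic_interval (j $ i) (n $ i)}"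

lemma dyadic_partition_cells: "dyadic_partition j = range (dyadic_cell j)"
  by (auto simp: dyadic_partition_def dyadic_cell_def dyadic_interval_def)

text \<open>Membership becomes an equation for the index, which makes existence and uniqueness of
  the cell of a point immediate.\<close>

lemma dyadic_interval_iff: "x \<in> dyadic_interval J n \<longleftrightarrow> n = \<lfloor>x * 2 powi J\<rfloor>"
proof -
  have "of_int n * 2 powi (- J) \<le> x \<longleftrightarrow> of_int n \<le> x * 2 powi J"
    "x < (of_int n + 1) * 2 powi (- J) \<longleftrightarrow> x * 2 powi J < of_int n + 1"
    by (simp_all add: power_int_minus field_simps)
  then show ?thesis
    by (simp only: dyadic_interval_def atLeastLessThan_iff eq_commute[of n] floor_eq_iff)
qed

text \<open>Dyadic intervals with a common point are nested: measured in units of the finer grid,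
  all endpoints are integers.\<close>

lemma dyadic_interval_nested:
  assumes "J \<le> J'" "x \<in> dyadic_interval J n" "x \<in> dyadic_interval J' n'"
  shows "of_int n * 2 powi (- J) \<le> (of_int n' :: real) * 2 powi (- J')"
    and "of_int n' * 2 powi (- J') + 2 powi (- J') \<le> of_int n * 2 powi (- J) + (2 powi (- J) :: real)"
proof -
  define m where "m = nat (J' - J)"
  have J: "2 powi (- J) = 2 ^ m * (2 powi (- J') :: real)"
    using assms(1) by (simp add: m_def flip: power_int_add power_int_of_nat)
  have pos: "(2 powi (- J') :: real) > 0" by simp
  have b: "of_int n * (2 ^ m * 2 powi (- J')) \<le> x" "x < (of_int n + 1) * (2 ^ m * 2 powi (- J'))"
    "of_int n' * 2 powi (- J') \<le> x" "x < (of_int n' + 1) * 2 powi (- J')"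
    using assms(2,3) unfolding dyadic_interval_def J by simp_all
  have "of_int n * 2 ^ m * (2 powi (- J') :: real) < (of_int n' + 1) * 2 powi (- J')"
    "(of_int n' :: real) * 2 powi (- J') < (of_int n + 1) * 2 ^ m * 2 powi (- J')"
    using b unfolding mult.assoc by linarith+
  then have "real_of_int (n * 2 ^ m) < real_of_int (n' + 1)"
    "real_of_int n' < real_of_int ((n + 1) * 2 ^ m)"
    using pos by simp_all
  \<comment> \<open>Integrality turns the strict inequalities expressing overlap into the weak ones
    expressing inclusion.\<close>
  then have le: "n * 2 ^ m \<le> n'" "n' + 1 \<le> (n + 1) * 2 ^ m"
    unfolding of_int_less_iff by simp_all
  from le(1) have "real_of_int (n * 2 ^ m) \<le> real_of_int n'" by (simp only: of_int_le_iff)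
  from mult_right_mono[OF this, of "2 powi (- J')"]
  show "of_int n * 2 powi (- J) \<le> (of_int n' :: real) * 2 powi (- J')"
    by (simp add: J algebra_simps)
  from le(2) have "real_of_int (n' + 1) \<le> real_of_int ((n + 1) * 2 ^ m)" by (simp only: of_int_le_iff)
  from mult_right_mono[OF this, of "2 powi (- J')"]
  show "of_int n' * 2 powi (- J') + 2 powi (- J') \<le> of_int n * 2 powi (- J) + (2 powi (- J) :: real)"
    by (simp add: J algebra_simps)
qed

lemma dyadic_cell_ex: "\<exists>n. x \<in> dyadic_cell j n"
  by (rule exI[of _ "\<chi> i. \<lfloor>x $ i * 2 powi (j $ i)\<rfloor>"]) (simp add: dyadic_cell_def dyadic_interval_iff)

lemma dyadic_cell_inj:
  assumes "x \<in> dyadic_cell j n" "x \<in> dyadic_cell j n'"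
  shows "n = n'"
  using assms by (simp add: dyadic_cell_def dyadic_interval_iff vec_eq_iff)

section \<open>Reduction to products of one-variable functions\<close>

lemma rat_polys_induct:
  assumes p: "p \<in> rat_polys r" and zero: "Q (\<lambda>_. 0)"
    and add: "\<And>f g. Q f \<Longrightarrow> Q g \<Longrightarrow> Q (\<lambda>x. f x + g x)"
    and cmult: "\<And>c f. Q f \<Longrightarrow> Q (\<lambda>x. c * f x)"
    and atom: "\<And>k. (\<And>i. k i \<le> r $ i) \<Longrightarrow> Q (\<lambda>x. \<Prod>i\<in>UNIV. x $ i ^ k i)"
  shows "Q p"
proof -
  obtain c where p: "p = (\<lambda>x. \<Sum>k | \<forall>i. k i \<le> r $ i. of_rat (c k) * (\<Prod>i\<in>UNIV. (x $ i) ^ k i))"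
    using p by (auto simp: rat_polys_def)
  have "Q (\<lambda>x. \<Sum>k\<in>F. of_rat (c k) * (\<Prod>i\<in>UNIV. (x $ i) ^ k i))"
    if "finite F" "F \<subseteq> {k. \<forall>i. k i \<le> r $ i}" for F
    using that
  proof induction
    case (insert k F)
    then show ?case by (simp add: add cmult atom)
  qed (simp add: zero)
  from this[OF finite_exponents] show ?thesis by (simp add: p)
qed

text \<open>Linear statements about a model need only be checked on monomials cut off to a cell.
  These are products over the coordinates, so their box integrals factorise.\<close>

lemma m_dir_induct:
  fixes r :: "nat^'d"
  assumes p: "p \<in> m_dir r (dyadic_partition j)" and zero: "Q (\<lambda>_. 0)"
    and add: "\<And>f g. Q f \<Longrightarrow> Q g \<Longrightarrow> Q (\<lambda>x. f x + g x)"
    and cmult: "\<And>c f. Q f \<Longrightarrow> Q (\<lambda>x. c * f x)"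
    and atom: "\<And>k n. (\<And>i. k i \<le> r $ i) \<Longrightarrow>
      Q (\<lambda>x. \<Prod>i\<in>UNIV. x $ i ^ k i * indicator (dyadic_interval (j $ i) (n $ i)) (x $ i))"
  shows "Q p"
proof -
  obtain f where p: "p = (\<lambda>x. \<Sum>I | I \<in> dyadic_partition j \<and> f I \<noteq> (\<lambda>_. 0). f I x * indicator I x)"
    and f: "\<And>I. I \<in> dyadic_partition j \<Longrightarrow> f I \<in> rat_polys r"
    and fin: "finite {I \<in> dyadic_partition j. f I \<noteq> (\<lambda>_. 0)}"
    using p by (auto simp: m_dir_def)
  have cell: "Q (\<lambda>x. g x * indicator (dyadic_cell j n) x)" if "g \<in> rat_polys r" for g n
    using that
  proof (rule rat_polys_induct[where Q="\<lambda>g. Q (\<lambda>x. g x * indicator (dyadic_cell j n) x)"])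
    fix k :: "'d \<Rightarrow> nat" assume k: "\<And>i. k i \<le> r $ i"
    have "indicator (dyadic_cell j n) x
        = (\<Prod>i\<in>UNIV. indicator (dyadic_interval (j $ i) (n $ i)) (x $ i) :: real)" for x
      by (auto simp: indicator_def dyadic_cell_def prod_zero_iff)
    then show "Q (\<lambda>x. (\<Prod>i\<in>UNIV. x $ i ^ k i) * indicator (dyadic_cell j n) x)"
      using atom[OF k, of n] by (simp add: prod.distrib)
  qed (use add cmult zero in \<open>simp_all add: distrib_right mult.assoc\<close>)
  have "Q (\<lambda>x. \<Sum>I\<in>F. f I x * indicator I x)" if "finite F" "F \<subseteq> dyadic_partition j" for F
    using that
  proof induction
    case (insert I F)
    then have "Q (\<lambda>x. f I x * indicator I x)"
      using f[of I] cell by (auto simp: dyadic_partition_cells)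
    from add[OF this insert.IH] show ?case
      using insert.prems by (simp only: sum.insert[OF insert.hyps] insert_subset simp_thms)
  qed (simp add: zero)
  from this[OF fin] show ?thesis by (simp add: p)
qed

lemma m_dir_on_cell:
  assumes p: "p \<in> m_dir r (dyadic_partition j)"
  obtains P where "P \<in> rat_polys r" "\<And>x. x \<in> dyadic_cell j n \<Longrightarrow> p x = P x"
proof -
  obtain f where p: "p = (\<lambda>x. \<Sum>I | I \<in> dyadic_partition j \<and> f I \<noteq> (\<lambda>_. 0). f I x * indicator I x)"
    and f: "\<And>I. I \<in> dyadic_partition j \<Longrightarrow> f I \<in> rat_polys r"
    and fin: "finite {I \<in> dyadic_partition j. f I \<noteq> (\<lambda>_. 0)}"
    using p by (auto simp: m_dir_def)
  let ?I = "dyadic_cell j n"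
  let ?S = "{I. I \<in> dyadic_partition j \<and> f I \<noteq> (\<lambda>_. 0)}"
  have "p x = f ?I x" if x: "x \<in> ?I" for x
  proof -
    have summand: "f I x * indicator I x = (if I = ?I then f I x else 0)" if I: "I \<in> ?S" for I
    proof -
      obtain n' where n': "I = dyadic_cell j n'" using I by (auto simp: dyadic_partition_cells)
      show ?thesis
      proof (cases "I = ?I")
        case True
        then show ?thesis using x by (simp only: indicator_simps simp_thms if_True mult_1_right)
      next
        case False
        then have "x \<notin> I" using dyadic_cell_inj[OF x] n' by blast
        then show ?thesis using False by (simp only: indicator_simps simp_thms if_False mult_zero_right)
      qed
    qed
    have "p x = (\<Sum>I\<in>?S. if I = ?I then f I x else 0)"
      unfolding p by (intro sum.cong refl summand)
    also have "\<dots> = (if ?I \<in> ?S then f ?I x else 0)"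
      using fin by (subst sum.delta) simp_all
    \<comment> \<open>A cell outside the index set carries the zero polynomial, so the value is the
      same.\<close>
    also have "\<dots> = f ?I x" by (simp add: dyadic_partition_cells)
    finally show ?thesis .
  qed
  with that[of "f ?I"] f[of ?I] show ?thesis by (simp add: dyadic_partition_cells)
qed

lemma rat_polys_coord_polys:
  assumes "p \<in> rat_polys r"
  shows "p \<in> coord_polys r"
  using assms
proof (rule rat_polys_induct[where Q="\<lambda>p. p \<in> coord_polys r"])
  fix k assume "\<And>i. k i \<le> r $ i"
  then show "(\<lambda>x. \<Prod>i\<in>UNIV. x $ i ^ k i) \<in> coord_polys r"
    using coord_polys_prod[of "\<lambda>i. monom 1 (k i)" r]
    by (simp add: poly_monom degree_monom_eq)
qed (auto intro: coord_polys_add coord_polys_cmult coord_polys_zero)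

lemma integrable_dyadic_monomial:
  "integrable lborel (\<lambda>t. t ^ k * indicator (dyadic_interval J n) t :: real)"
proof -
  have "set_integrable lborel (dyadic_interval J n) (\<lambda>t. t ^ k :: real)"
    unfolding dyadic_interval_def
    by (rule set_integrable_subset[where A="{of_int n * 2 powi (- J) .. (of_int n + 1) * 2 powi (- J)}"],
        rule borel_integrable_atLeastAtMost') (auto intro: continuous_intros)
  then show ?thesis by (simp add: set_integrable_def mult.commute)
qed

lemma m_dir_integrable:
  assumes "p \<in> m_dir r (dyadic_partition j)"
  shows "integrable lborel p"
  using assms
proof (rule m_dir_induct[where Q="integrable lborel"])
  show "integrable lborel (\<lambda>x. \<Prod>i\<in>UNIV. x $ i ^ k i *
      indicator (dyadic_interval (j $ i) (n $ i)) (x $ i))" for k and n :: "int^'a"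
    by (rule lborel_integral_prod_cart(1)) (rule integrable_dyadic_monomial)
qed simp_all

section \<open>Interpolation in several directions\<close>

definition shift_nodes :: "'d set \<Rightarrow> ('d \<Rightarrow> nat \<Rightarrow> real) \<Rightarrow> ('d \<Rightarrow> nat) \<Rightarrow> real^'d \<Rightarrow> real^'d" where
  "shift_nodes T y \<kappa> u = (\<chi> i. if i \<in> T then y i (\<kappa> i) else u $ i)"

text \<open>Tensor product Lagrange interpolation in the directions of \<open>T\<close>, applied to
  a function \<Phi> of the left corner of a window; the other coordinates of the corner stay
  fixed.\<close>

definition node_interpolate ::
  "nat^'d \<Rightarrow> 'd set \<Rightarrow> ('d \<Rightarrow> nat \<Rightarrow> real) \<Rightarrow> ('d \<Rightarrow> nat \<Rightarrow> real poly) \<Rightarrow> (real^'d \<Rightarrow> real) \<Rightarrow> real^'d \<Rightarrow> real"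
  where "node_interpolate r T y L \<Phi> u =
    (\<Sum>\<kappa>\<in>PiE T (\<lambda>i. {..r $ i}). (\<Prod>i\<in>T. poly (L i (\<kappa> i)) (u $ i)) * \<Phi> (shift_nodes T y \<kappa> u))"

lemma node_interpolate_add:
  "node_interpolate r T y L (\<lambda>u. \<Phi> u + \<Psi> u) u = node_interpolate r T y L \<Phi> u + node_interpolate r T y L \<Psi> u"
  by (simp add: node_interpolate_def sum.distrib algebra_simps)

lemma node_interpolate_diff:
  "node_interpolate r T y L (\<lambda>u. \<Phi> u - \<Psi> u) u = node_interpolate r T y L \<Phi> u - node_interpolate r T y L \<Psi> u"
  by (simp add: node_interpolate_def sum_subtractf algebra_simps)

lemma node_interpolate_cmult:
  "node_interpolate r T y L (\<lambda>u. c * \<Phi> u) u = c * node_interpolate r T y L \<Phi> u"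
  by (simp add: node_interpolate_def sum_distrib_left algebra_simps)

lemma node_interpolate_cong:
  assumes "\<And>\<kappa>. \<kappa> \<in> PiE T (\<lambda>i. {..r $ i}) \<Longrightarrow> \<Phi> (shift_nodes T y \<kappa> u) = \<Psi> (shift_nodes T y \<kappa> u)"
  shows "node_interpolate r T y L \<Phi> u = node_interpolate r T y L \<Psi> u"
  using assms by (simp add: node_interpolate_def)

text \<open>The sum has one term for each choice of nodes, and all Lagrange weights are at most 1.
  This is the source of the factor \<open>D\<close> in the final bound.\<close>

lemma abs_node_interpolate_le:
  assumes "\<And>i k. i \<in> T \<Longrightarrow> k \<le> r $ i \<Longrightarrow> \<bar>poly (L i k) (u $ i)\<bar> \<le> 1"
    and "\<And>v. \<bar>\<Phi> v\<bar> \<le> B"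
  shows "\<bar>node_interpolate r T y L \<Phi> u\<bar> \<le> real (\<Prod>i\<in>T. r $ i + 1) * B"
proof -
  have "\<bar>node_interpolate r T y L \<Phi> u\<bar> \<le> (\<Sum>\<kappa>\<in>PiE T (\<lambda>i. {..r $ i}). 1 * B)"
    unfolding node_interpolate_def
  proof (rule order_trans[OF sum_abs], rule sum_mono)
    fix \<kappa> assume \<kappa>: "\<kappa> \<in> PiE T (\<lambda>i. {..r $ i})"
    have "\<bar>\<Prod>i\<in>T. poly (L i (\<kappa> i)) (u $ i)\<bar> \<le> 1"
      unfolding abs_prod using \<kappa> assms(1) by (intro prod_le_1) auto
    then show "\<bar>(\<Prod>i\<in>T. poly (L i (\<kappa> i)) (u $ i)) * \<Phi> (shift_nodes T y \<kappa> u)\<bar> \<le> 1 * B"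
      unfolding abs_mult using assms(2) by (intro mult_mono) auto
  qed
  also have "\<dots> = real (\<Prod>i\<in>T. r $ i + 1) * B"
    by (simp add: card_PiE)
  finally show ?thesis .
qed

lemma set_integral_poly_sum:
  fixes a b :: real
  shows "(LINT t:{a<..<b}|lborel. poly (\<Sum>m\<in>A. smult (c m) (e m)) t)
    = (\<Sum>m\<in>A. c m * (LINT t:{a<..<b}|lborel. poly (e m) t))"
proof (induction A rule: infinite_finite_induct)
  case (insert m A)
  have "(LINT t:{a<..<b}|lborel. poly (\<Sum>m\<in>insert m A. smult (c m) (e m)) t)
      = (LINT t:{a<..<b}|lborel. c m * poly (e m) t + poly (\<Sum>m\<in>A. smult (c m) (e m)) t)"
    using insert.hyps by simp
  also have "\<dots> = c m * (LINT t:{a<..<b}|lborel. poly (e m) t)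
      + (LINT t:{a<..<b}|lborel. poly (\<Sum>m\<in>A. smult (c m) (e m)) t)"
    by (subst set_integral_add) (auto intro: set_integrable_poly)
  finally show ?case using insert by simp
qed (simp_all add: set_lebesgue_integral_def)

text \<open>Both box integrals factorise; multiplying out the one-dimensional interpolation formulas
  over \<open>T\<close> gives the sum over all choices of nodes.\<close>

lemma box_integral_prod_interpolate:
  fixes G H :: "'d::finite \<Rightarrow> real \<Rightarrow> real" and u w :: "real^'d"
  assumes G: "\<And>i s. set_integrable lborel {s<..<s + w $ i} (G i)"
    and H: "\<And>i. set_integrable lborel {u $ i<..<u $ i + w $ i} (H i)"
    and inT: "\<And>i. i \<in> T \<Longrightarrow> (LINT t:{u $ i<..<u $ i + w $ i}|lborel. H i t) =
      (\<Sum>k\<le>r $ i. poly (L i k) (u $ i) * (LINT t:{y i k<..<y i k + w $ i}|lborel. G i t))"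
    and notT: "\<And>i. i \<notin> T \<Longrightarrow> (LINT t:{u $ i<..<u $ i + w $ i}|lborel. H i t) =
      (LINT t:{u $ i<..<u $ i + w $ i}|lborel. G i t)"
  shows "(LINT x:box u (u + w)|lborel. (\<Prod>i\<in>UNIV. H i (x $ i))) =
    node_interpolate r T y L (\<lambda>v. LINT x:box v (v + w)|lborel. (\<Prod>i\<in>UNIV. G i (x $ i))) u"
proof -
  define \<gamma> where "\<gamma> i s = (LINT t:{s<..<s + w $ i}|lborel. G i t)" for i s
  have split: "prod f UNIV = prod f T * prod f (-T)" for f :: "'d \<Rightarrow> real"
    by (subst prod.union_disjoint[symmetric]) auto
  have \<Phi>: "(LINT x:box v (v + w)|lborel. (\<Prod>i\<in>UNIV. G i (x $ i))) = (\<Prod>i\<in>UNIV. \<gamma> i (v $ i))" for v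
    unfolding \<gamma>_def by (rule box_integral_prod) (rule G)
  have "(LINT x:box u (u + w)|lborel. (\<Prod>i\<in>UNIV. H i (x $ i)))
      = (\<Prod>i\<in>UNIV. LINT t:{u $ i<..<u $ i + w $ i}|lborel. H i t)"
    by (rule box_integral_prod) (rule H)
  also have "\<dots> = (\<Prod>i\<in>T. \<Sum>k\<le>r $ i. poly (L i k) (u $ i) * \<gamma> i (y i k)) * (\<Prod>i\<in>-T. \<gamma> i (u $ i))"
    unfolding split by (intro arg_cong2[of _ _ _ _ "(*)"] prod.cong) (auto simp: inT notT \<gamma>_def)
  also have "(\<Prod>i\<in>T. \<Sum>k\<le>r $ i. poly (L i k) (u $ i) * \<gamma> i (y i k))
      = (\<Sum>\<kappa>\<in>PiE T (\<lambda>i. {..r $ i}). \<Prod>i\<in>T. poly (L i (\<kappa> i)) (u $ i) * \<gamma> i (y i (\<kappa> i)))"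
    by (rule prod_sum_PiE) auto
  also have "\<dots> * (\<Prod>i\<in>-T. \<gamma> i (u $ i)) = (\<Sum>\<kappa>\<in>PiE T (\<lambda>i. {..r $ i}).
      (\<Prod>i\<in>T. poly (L i (\<kappa> i)) (u $ i)) * (\<Prod>i\<in>UNIV. \<gamma> i (shift_nodes T y \<kappa> u $ i)))"
    unfolding sum_distrib_right split
    by (intro sum.cong refl) (simp add: prod.distrib shift_nodes_def mult.assoc)
  finally show ?thesis
    unfolding node_interpolate_def \<Phi> .
qed

text \<open>Interpolation is exact on polynomials: both sides are linear in \<open>P\<close>, and
  for a monomial the preceding lemma applies with \<open>H = G\<close>.\<close>

lemma rat_poly_box_integral_interpolate:
  fixes w :: "real^'d"
  assumes P: "P \<in> rat_polys r"
    and L: "\<And>i F s. i \<in> T \<Longrightarrow> degree F \<le> r $ i \<Longrightarrow> (LINT t:{s<..<s + w $ i}|lborel. poly F t) =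
       (\<Sum>k\<le>r $ i. poly (L i k) s * (LINT t:{y i k<..<y i k + w $ i}|lborel. poly F t))"
  shows "(LINT x:box u (u + w)|lborel. P x) =
    node_interpolate r T y L (\<lambda>v. LINT x:box v (v + w)|lborel. P x) u"
proof -
  define Q where "Q P \<longleftrightarrow> P \<in> coord_polys r \<and> (\<forall>u.
    node_interpolate r T y L (\<lambda>v. LINT x:box v (v + w)|lborel. P x) u = (LINT x:box u (u + w)|lborel. P x))" for P
  have "Q P"
    using P
  proof (rule rat_polys_induct[where Q=Q])
    show "Q (\<lambda>_. 0)"
      by (simp add: Q_def coord_polys_zero node_interpolate_def)
    show "Q (\<lambda>x. f x + g x)" if "Q f" "Q g" for f g
      using that set_integrable_coord_poly[of f r] set_integrable_coord_poly[of g r]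
      by (simp add: Q_def coord_polys_add node_interpolate_add)
    show "Q (\<lambda>x. c * f x)" if "Q f" for c f
      using that by (simp add: Q_def coord_polys_cmult node_interpolate_cmult)
    fix k assume k: "\<And>i. k i \<le> r $ i"
    have "(\<lambda>x. \<Prod>i\<in>UNIV. poly (monom 1 (k i)) (x $ i)) \<in> coord_polys r"
      using k by (intro coord_polys_prod) (simp add: degree_monom_eq)
    moreover have "node_interpolate r T y L (\<lambda>v. LINT x:box v (v + w)|lborel. (\<Prod>i\<in>UNIV. poly (monom 1 (k i)) (x $ i))) u =
      (LINT x:box u (u + w)|lborel. (\<Prod>i\<in>UNIV. poly (monom 1 (k i)) (x $ i)))" for u
      by (rule sym, rule box_integral_prod_interpolate) (use k L in \<open>auto simp: set_integrable_poly degree_monom_eq\<close>)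
    ultimately show "Q (\<lambda>x. \<Prod>i\<in>UNIV. x $ i ^ k i)"
      by (simp add: Q_def poly_monom)
  qed
  then show ?thesis by (simp add: Q_def)
qed

text \<open>In the directions outside \<open>T\<close> the function \<open>q\<close> is polynomial on the whole interval
  \<open>dyadic_interval (j $ i) (N $ i)\<close>; interpolating its window integrals in the directions of
  \<open>T\<close> yields a single polynomial.\<close>

lemma m_dir_interpolant:
  fixes w :: "real^'d"
  assumes q: "q \<in> m_dir r (dyadic_partition j)"
    and e: "\<And>i k. i \<in> T \<Longrightarrow> k \<le> r $ i \<Longrightarrow> degree (e i k) \<le> r $ i"
      "\<And>i k s. i \<in> T \<Longrightarrow> k \<le> r $ i \<Longrightarrow> (LINT t:{s<..<s + w $ i}|lborel. poly (e i k) t) = poly (L i k) s"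
  shows "\<exists>q1\<in>coord_polys r. \<forall>u.
    (\<forall>i. i \<notin> T \<longrightarrow> {u $ i<..<u $ i + w $ i} \<subseteq> dyadic_interval (j $ i) (N $ i)) \<longrightarrow>
    (LINT x:box u (u + w)|lborel. q1 x) =
    node_interpolate r T y L (\<lambda>v. LINT x:box v (v + w)|lborel. q x) u"
proof -
  define ok where "ok u \<longleftrightarrow> (\<forall>i. i \<notin> T \<longrightarrow> {u $ i<..<u $ i + w $ i} \<subseteq> dyadic_interval (j $ i) (N $ i))" for u
  \<comment> \<open>Integrability is carried along so that box integrals of sums can be
    split.\<close>
  define Q where "Q f \<longleftrightarrow> integrable lborel f \<and> (\<exists>g\<in>coord_polys r. \<forall>u. ok u \<longrightarrow>
      (LINT x:box u (u + w)|lborel. g x) =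
      node_interpolate r T y L (\<lambda>v. LINT x:box v (v + w)|lborel. f x) u)" for f
  have int: "set_integrable lborel (box u v) f" if "integrable lborel f" for f :: "real^'d \<Rightarrow> real" and u v
    unfolding set_integrable_def by (rule integrable_mult_indicator[OF _ that]) simp
  have "Q q"
    using q
  proof (rule m_dir_induct[where Q=Q])
    show "Q (\<lambda>_. 0)"
      by (auto simp: Q_def node_interpolate_def intro!: bexI[OF _ coord_polys_zero])
    show "Q (\<lambda>x. f x + g x)" if fg: "Q f" "Q g" for f g
    proof -
      obtain f' g' where *: "f' \<in> coord_polys r" "g' \<in> coord_polys r" and
        "\<forall>u. ok u \<longrightarrow> (LINT x:box u (u + w)|lborel. f' x) =
          node_interpolate r T y L (\<lambda>v. LINT x:box v (v + w)|lborel. f x) u"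
        "\<forall>u. ok u \<longrightarrow> (LINT x:box u (u + w)|lborel. g' x) =
          node_interpolate r T y L (\<lambda>v. LINT x:box v (v + w)|lborel. g x) u"
        using fg unfolding Q_def by blast
      moreover have "integrable lborel f" "integrable lborel g" using fg by (auto simp: Q_def)
      ultimately show ?thesis
        unfolding Q_def
        by (intro conjI bexI[OF _ coord_polys_add[OF *]])
          (simp_all add: int set_integrable_coord_poly[OF *(1)] set_integrable_coord_poly[OF *(2)] node_interpolate_add)
    qed
    show "Q (\<lambda>x. c * f x)" if f: "Q f" for c f
    proof -
      obtain f' where *: "f' \<in> coord_polys r" and
        "\<forall>u. ok u \<longrightarrow> (LINT x:box u (u + w)|lborel. f' x) =
          node_interpolate r T y L (\<lambda>v. LINT x:box v (v + w)|lborel. f x) u"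
        using f unfolding Q_def by blast
      moreover have "integrable lborel f" using f by (auto simp: Q_def)
      ultimately show ?thesis
        unfolding Q_def
        by (intro conjI bexI[OF _ coord_polys_cmult[OF *, of c]]) (simp_all add: node_interpolate_cmult)
    qed
    fix k :: "'d \<Rightarrow> nat" and n :: "int^'d" assume k: "\<And>i. k i \<le> r $ i"
    define G :: "'d \<Rightarrow> real \<Rightarrow> real" where "G i t = t ^ k i * indicator (dyadic_interval (j $ i) (n $ i)) t" for i t
    \<comment> \<open>In a direction of \<open>T\<close>, the dual polynomials produce the
      interpolated window integrals of \<open>G i\<close>. In any other direction the window lies in
      the interval with index \<open>N $ i\<close>, where \<open>G i\<close> is the full monomial or
      zero.\<close>
    define H where "H i = (if i \<in> T then \<Sum>m\<le>r $ i. smult (LINT t:{y i m<..<y i m + w $ i}|lborel. G i t) (e i m)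
      else if n $ i = N $ i then monom 1 (k i) else 0)" for i
    have intG: "integrable lborel (G i)" for i
      unfolding G_def by (rule integrable_dyadic_monomial)
    have setG: "set_integrable lborel {s<..<s'} (G i)" for i s s'
      unfolding set_integrable_def by (rule integrable_mult_indicator[OF _ intG]) simp
    have degH: "degree (H i) \<le> r $ i" for i
      using k[of i] e(1)[of i]
      by (auto simp: H_def degree_monom_eq intro!: degree_sum_le order_trans[OF degree_smult_le])
    have "(LINT x:box u (u + w)|lborel. (\<Prod>i\<in>UNIV. poly (H i) (x $ i))) =
      node_interpolate r T y L (\<lambda>v. LINT x:box v (v + w)|lborel. (\<Prod>i\<in>UNIV. G i (x $ i))) u"
      if "ok u" for u
    proof (rule box_integral_prod_interpolate)
      fix i assume i: "i \<in> T"
      then show "(LINT t:{u $ i<..<u $ i + w $ i}|lborel. poly (H i) t)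
          = (\<Sum>m\<le>r $ i. poly (L i m) (u $ i) * (LINT t:{y i m<..<y i m + w $ i}|lborel. G i t))"
        by (simp add: H_def set_integral_poly_sum e(2) mult.commute)
    next
      fix i assume i: "i \<notin> T"
      have sub: "{u $ i<..<u $ i + w $ i} \<subseteq> dyadic_interval (j $ i) (N $ i)"
        using \<open>ok u\<close> i by (auto simp: ok_def)
      show "(LINT t:{u $ i<..<u $ i + w $ i}|lborel. poly (H i) t) =
        (LINT t:{u $ i<..<u $ i + w $ i}|lborel. G i t)"
      proof (rule set_lebesgue_integral_cong)
        show "\<forall>t. t \<in> {u $ i<..<u $ i + w $ i} \<longrightarrow> poly (H i) t = G i t"
        proof (intro allI impI)
          fix t assume "t \<in> {u $ i<..<u $ i + w $ i}"
          then have "t \<in> dyadic_interval (j $ i) (N $ i)" using sub by blast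
          then have "t \<in> dyadic_interval (j $ i) (n $ i) \<longleftrightarrow> n $ i = N $ i"
            by (simp add: dyadic_interval_iff)
          then show "poly (H i) t = G i t"
            using i by (auto simp: H_def G_def poly_monom indicator_def)
        qed
      qed simp
    qed (use setG set_integrable_poly in auto)
    moreover have "integrable lborel (\<lambda>x::real^'d. \<Prod>i\<in>UNIV. G i (x $ i))"
      by (rule lborel_integral_prod_cart(1)) (rule intG)
    ultimately show "Q (\<lambda>x. \<Prod>i\<in>UNIV. x $ i ^ k i * indicator (dyadic_interval (j $ i) (n $ i)) (x $ i))"
      unfolding Q_def G_def[symmetric] using coord_polys_prod[of H r, OF degH] by blast
  qed
  then show ?thesis unfolding Q_def ok_def by (rule conjunct2)
qed

section \<open>The bound for two grids\<close>

lemma prod_powi: "(\<Prod>i\<in>A. 2 powi (f i)) = (2 powi (\<Sum>i\<in>A. f i) :: real)"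
  by (induction A rule: infinite_finite_induct) (simp_all add: power_int_add)

definition window_ratio :: "nat^'d \<Rightarrow> real" where
  "window_ratio r = 1 / (8 * (real (\<Sum>i\<in>UNIV. r $ i))\<^sup>2)"

text \<open>This accounts for the constants of \<open>model_h\<close>: the \<open>d\<close>-th power
  of 8 splits into those of 2 and 4, and one factor 4 remains. Adding \<open>h\<close> to the volume
  of such a window thus costs at most a factor 5/4.\<close>

lemma window_volume:
  fixes r :: "nat^'d"
  shows "(\<Prod>i\<in>UNIV. window_ratio r * 2 powi (- (j $ i))) = 4 * model_h r j"
proof -
  define R where "R = (real (\<Sum>i\<in>UNIV. r $ i))\<^sup>2"
  define X :: real where "X = 2 powi (- (\<Sum>i\<in>UNIV. j $ i))"
  have "(8 * R) ^ CARD('d) = (2 * R * 4) ^ CARD('d)" by simp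
  also have "\<dots> = (2 * R) ^ CARD('d) * 4 ^ CARD('d)" by (rule power_mult_distrib)
  finally have eq: "(8 * R) ^ CARD('d) = (2 * R) ^ CARD('d) * 4 ^ CARD('d)" .
  have "(\<Prod>i\<in>UNIV. window_ratio r * 2 powi (- (j $ i))) = window_ratio r ^ CARD('d) * X"
    unfolding prod.distrib prod_powi sum_negf X_def by simp
  also have "window_ratio r ^ CARD('d) = 1 / ((2 * R) ^ CARD('d) * 4 ^ CARD('d))"
    unfolding window_ratio_def R_def[symmetric] power_one_over eq ..
  also have "\<dots> * X = 4 * (X / ((2 * R) ^ CARD('d) * 4 ^ (CARD('d) + 1)))" by simp
  finally show ?thesis unfolding model_h_def R_def X_def .
qed

lemma window_ratio_bounds:
  fixes r :: "nat^'d"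
  assumes "r \<noteq> 0"
  shows "0 < window_ratio r" "window_ratio r \<le> 1 / 8"
    "8 * window_ratio r * (\<Sum>i\<in>UNIV. (real (r $ i))\<^sup>2) \<le> 1"
proof -
  define R where "R = (\<Sum>i\<in>UNIV. r $ i)"
  obtain i where i: "r $ i \<noteq> 0" using assms by (auto simp: vec_eq_iff)
  have le: "r $ i \<le> R" for i unfolding R_def by (rule member_le_sum) auto
  have R: "real R \<ge> 1" using le[of i] i by simp
  then have R2: "(real R)\<^sup>2 \<ge> 1" by simp
  have "0 < 1 / (8 * (real R)\<^sup>2)"
    using R2 by (intro divide_pos_pos) linarith+
  moreover have "1 / (8 * (real R)\<^sup>2) \<le> 1 / 8"
    using R2 by (intro divide_left_mono) linarith+
  ultimately have "0 < 1 / (8 * (real R)\<^sup>2)" "1 / (8 * (real R)\<^sup>2) \<le> 1 / 8" .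
  then show "0 < window_ratio r" "window_ratio r \<le> 1 / 8"
    unfolding window_ratio_def R_def .
  have "(\<Sum>i\<in>UNIV. (real (r $ i))\<^sup>2) \<le> (\<Sum>i\<in>UNIV. real (r $ i) * real R)"
    unfolding power2_eq_square by (intro sum_mono mult_left_mono) (auto simp: le)
  also have "\<dots> = (real R)\<^sup>2"
    unfolding power2_eq_square sum_distrib_right[symmetric] by (simp add: R_def)
  finally show "8 * window_ratio r * (\<Sum>i\<in>UNIV. (real (r $ i))\<^sup>2) \<le> 1"
    using R2 unfolding window_ratio_def R_def[symmetric] by (simp add: divide_le_eq)
qed

lemma dyadic_window_subset:
  assumes "of_int n * 2 powi (- J) \<le> s" "s + w \<le> of_int n * 2 powi (- J) + 2 powi (- J)"
  shows "{s<..<s + w} \<subseteq> dyadic_interval J n"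
  using assms by (auto simp: dyadic_interval_def algebra_simps)

lemma dyadic_cell_cbox:
  assumes "x \<in> dyadic_cell j n"
  shows "x \<in> cbox (\<chi> i. of_int (n $ i) * 2 powi (- (j $ i)))
    ((\<chi> i. of_int (n $ i) * 2 powi (- (j $ i))) + (\<chi> i. 2 powi (- (j $ i))))"
  using assms by (auto simp: dyadic_cell_def dyadic_interval_def mem_box_cart algebra_simps intro: less_imp_le)

text \<open>Directions in which the grids agree may lie in \<open>T\<close> or outside it, so the
  lemma also applies with the grids exchanged and \<open>T\<close> replaced by its
  complement.\<close>

lemma two_grids_bound:
  fixes r :: "nat^'d" and j j' :: "int^'d"
  assumes r: "r \<noteq> 0"
    and T: "\<And>i. i \<in> T \<Longrightarrow> j $ i \<le> j' $ i" "\<And>i. i \<notin> T \<Longrightarrow> j' $ i \<le> j $ i"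
    and p: "p \<in> m_dir r (dyadic_partition j)" and q: "q \<in> m_dir r (dyadic_partition j')"
    and h: "h \<le> model_h r j" "h \<le> model_h r j'" and A: "0 \<le> A"
    and bnd: "\<And>u w. (\<And>i. 0 < w $ i) \<Longrightarrow> \<bar>LINT x:box u (u + w)|lborel. p x - q x\<bar>
      \<le> A * (measure lborel (box u (u + w)) + h)"
  shows "\<bar>p x - q x\<bar> \<le> A * (5 / 2 + 15 / 2 * real (\<Prod>i\<in>T. r $ i + 1))"
proof -
  define D where "D = real (\<Prod>i\<in>T. r $ i + 1)"
  define \<delta> where "\<delta> = window_ratio r"
  have \<delta>: "0 < \<delta>" "\<delta> \<le> 1 / 2" "\<delta> < 1" "8 * \<delta> * (\<Sum>i\<in>UNIV. (real (r $ i))\<^sup>2) \<le> 1"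
    using window_ratio_bounds[OF r] by (auto simp: \<delta>_def)
  define len :: "int^'d \<Rightarrow> real^'d" where "len J = (\<chi> i. 2 powi (- (J $ i)))" for J :: "int^'d"
  define corner :: "int^'d \<Rightarrow> int^'d \<Rightarrow> real^'d"
    where "corner J n = (\<chi> i. of_int (n $ i) * 2 powi (- (J $ i)))" for J n :: "int^'d"
  have len0: "len J $ i > 0" for J i by (simp add: len_def)
  have vol: "measure lborel (box u (u + \<delta> *\<^sub>R len J)) = 4 * model_h r J" for J u
    using \<delta>(1) window_volume[of r J]
    by (subst measure_box_cart) (auto simp: len_def \<delta>_def)
  have bnd': "\<bar>LINT x:box u (u + \<delta> *\<^sub>R len J)|lborel. p x - q x\<bar>
      \<le> 5 / 4 * A * measure lborel (box u (u + \<delta> *\<^sub>R len J))" if "J = j \<or> J = j'" for u J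
  proof -
    have "\<bar>LINT x:box u (u + \<delta> *\<^sub>R len J)|lborel. p x - q x\<bar>
        \<le> A * (measure lborel (box u (u + \<delta> *\<^sub>R len J)) + h)"
      using \<delta>(1) len0 by (intro bnd) simp
    also have "\<dots> \<le> A * (5 / 4 * measure lborel (box u (u + \<delta> *\<^sub>R len J)))"
      using that h A by (intro mult_left_mono) (auto simp: vol)
    finally show ?thesis by simp
  qed
  have int_pq: "set_integrable lborel (box u v) p" "set_integrable lborel (box u v) q" for u v
    unfolding set_integrable_def
    by (rule integrable_mult_indicator[OF _ m_dir_integrable[OF p]], simp)
      (rule integrable_mult_indicator[OF _ m_dir_integrable[OF q]], simp)

  \<comment> \<open>The coarser exponent in each direction, that is, the grid of the common
    coarsening.\<close>
  define c where "c = (\<chi> i. if i \<in> T then j $ i else j' $ i)"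
  obtain N where xN: "x \<in> dyadic_cell c N" using dyadic_cell_ex by blast
  define w where "w = \<delta> *\<^sub>R len j"
  have w: "w $ i = \<delta> * 2 powi (- (j $ i))" for i by (simp add: w_def len_def)
  have "\<exists>y L e. window_system (r $ i) (corner c N $ i) (len j $ i) (w $ i) y L e" for i
    using \<delta>(1,3) by (intro window_system_exists) (simp_all add: w len_def)
  then obtain y L e where
    ws: "\<And>i. window_system (r $ i) (corner c N $ i) (len j $ i) (w $ i) (y i) (L i) (e i)"
    by metis
  note y = window_systemD(1)[OF ws] and e = window_systemD(2,3)[OF ws] and L = window_systemD(4,5)[OF ws]
  obtain q1 where q1: "q1 \<in> coord_polys r" and
    q1_int: "\<forall>u. (\<forall>i. i \<notin> T \<longrightarrow> {u $ i<..<u $ i + w $ i} \<subseteq> dyadic_interval (j' $ i) (N $ i)) \<longrightarrow>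
      (LINT x:box u (u + w)|lborel. q1 x) =
      node_interpolate r T y L (\<lambda>v. LINT x:box v (v + w)|lborel. q x) u"
    by (rule bexE[OF m_dir_interpolant[OF q e(1) e(2), where y=y and N=N and T=T]])

  \<comment> \<open>The factor 2 comes from \<open>sup_le_of_averages\<close>, \<open>D\<close> from
    the interpolation and 5/4 from \<open>bnd'\<close>.\<close>
  define \<beta> where "\<beta> = 2 * (D * (5 / 4 * A))"
  have f1: "\<bar>p z - q1 z\<bar> \<le> \<beta>" if z: "z \<in> dyadic_cell c N" for z
  proof -
    obtain n where zn: "z \<in> dyadic_cell j n" using dyadic_cell_ex by blast
    obtain P where P: "P \<in> rat_polys r" and pP: "\<And>x. x \<in> dyadic_cell j n \<Longrightarrow> p x = P x"
      using m_dir_on_cell[OF p] by blast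
    have zi: "z $ i \<in> dyadic_interval (j $ i) (n $ i)" "z $ i \<in> dyadic_interval (c $ i) (N $ i)" for i
      using z zn by (auto simp: dyadic_cell_def)
    \<comment> \<open>In the directions of \<open>T\<close> the coarse grid is \<open>j\<close>
      itself, so the nodes chosen for the coarse cell also lie in the cell of
      \<open>z\<close>.\<close>
    have nT: "n $ i = N $ i" if "i \<in> T" for i
      using zi[of i] that by (simp add: dyadic_interval_iff c_def)
    have PC: "(\<lambda>x. P x - q1 x) \<in> coord_polys r"
      by (intro coord_polys_diff rat_polys_coord_polys P q1)
    have "\<bar>P z - q1 z\<bar> \<le> 2 * (D * (5 / 4 * A))"
    proof (rule sup_le_of_averages[OF PC, where \<delta>=\<delta> and a="corner j n" and l="len j"])
      show "z \<in> cbox (corner j n) (corner j n + len j)"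
        using dyadic_cell_cbox[OF zn] by (simp add: corner_def len_def)
      fix u assume u: "\<And>i. corner j n $ i \<le> u $ i \<and> u $ i + \<delta> * len j $ i \<le> corner j n $ i + len j $ i"
      then have ui: "{u $ i<..<u $ i + w $ i} \<subseteq> dyadic_interval (j $ i) (n $ i)" for i
        using u[of i] by (intro dyadic_window_subset) (auto simp: corner_def len_def w)
      have q1u: "(LINT x:box u (u + w)|lborel. q1 x) =
          node_interpolate r T y L (\<lambda>v. LINT x:box v (v + w)|lborel. q x) u"
      proof (rule q1_int[rule_format])
        fix i assume i: "i \<notin> T"
        then have "z $ i \<in> dyadic_interval (j' $ i) (N $ i)" using zi(2)[of i] by (simp add: c_def)
        \<comment> \<open>Outside \<open>T\<close> the grid \<open>j\<close> is at least as fine as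
          \<open>j'\<close>, so the window stays in one interval of \<open>j'\<close>.\<close>
        from dyadic_interval_nested[OF T(2)[OF i] this zi(1)]
        show "{u $ i<..<u $ i + w $ i} \<subseteq> dyadic_interval (j' $ i) (N $ i)"
          using u[of i] by (intro dyadic_window_subset) (auto simp: corner_def len_def w)
      qed
      have Pu: "(LINT x:box u (u + w)|lborel. P x) =
          node_interpolate r T y L (\<lambda>v. LINT x:box v (v + w)|lborel. p x) u"
      proof -
        have "(LINT x:box u (u + w)|lborel. P x) =
            node_interpolate r T y L (\<lambda>v. LINT x:box v (v + w)|lborel. P x) u"
          by (rule rat_poly_box_integral_interpolate[OF P L(2)])
        also have "\<dots> = node_interpolate r T y L (\<lambda>v. LINT x:box v (v + w)|lborel. p x) u"
        proof (rule node_interpolate_cong, rule set_lebesgue_integral_cong)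
          fix \<kappa> assume \<kappa>: "\<kappa> \<in> PiE T (\<lambda>i. {..r $ i})"
          let ?v = "shift_nodes T y \<kappa> u"
          \<comment> \<open>Shifted windows remain in the cell of \<open>z\<close>, where
            \<open>p\<close> coincides with \<open>P\<close>; this allows \<open>p\<close> in place
            of \<open>P\<close> under the interpolation.\<close>
          have vi: "{?v $ i<..<?v $ i + w $ i} \<subseteq> dyadic_interval (j $ i) (n $ i)" for i
          proof (cases "i \<in> T")
            case True
            then have "\<kappa> i \<le> r $ i" using \<kappa> by auto
            from y[OF this] show ?thesis
              using True nT[OF True]
              by (intro dyadic_window_subset) (auto simp: shift_nodes_def corner_def len_def c_def)
          qed (use ui in \<open>auto simp: shift_nodes_def\<close>)
          show "\<forall>x. x \<in> box ?v (?v + w) \<longrightarrow> P x = p x"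
          proof (intro allI impI)
            fix x assume "x \<in> box ?v (?v + w)"
            then have "x \<in> dyadic_cell j n"
              using vi by (force simp: mem_box_cart dyadic_cell_def)
            then show "P x = p x" using pP by simp
          qed
        qed simp
        finally show ?thesis .
      qed
      \<comment> \<open>Both terms are interpolated at the same nodes, so by linearity only window
        integrals of \<open>p - q\<close> enter, and \<open>bnd'\<close> holds for these wherever
        the windows lie.\<close>
      have "(LINT x:box u (u + w)|lborel. P x - q1 x)
          = node_interpolate r T y L (\<lambda>v. LINT x:box v (v + w)|lborel. p x - q x) u"
        using set_integrable_coord_poly[OF q1] set_integrable_coord_poly[OF rat_polys_coord_polys[OF P]] int_pq
        by (simp add: Pu q1u flip: node_interpolate_diff)
      also have "\<bar>\<dots>\<bar> \<le> D * (5 / 4 * A * (4 * model_h r j))"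
        unfolding D_def
      proof (rule abs_node_interpolate_le)
        fix i k assume "i \<in> T" "k \<le> r $ i"
        then show "\<bar>poly (L i k) (u $ i)\<bar> \<le> 1"
          using u[of i] nT[of i] by (intro L(1)) (auto simp: corner_def len_def c_def w)
      next
        show "\<bar>LINT x:box v (v + w)|lborel. p x - q x\<bar> \<le> 5 / 4 * A * (4 * model_h r j)" for v
          using bnd'[of j v] unfolding w_def vol by simp
      qed
      finally show "\<bar>LINT x:box u (u + \<delta> *\<^sub>R len j)|lborel. P x - q1 x\<bar>
          \<le> D * (5 / 4 * A) * measure lborel (box u (u + \<delta> *\<^sub>R len j))"
        by (simp add: w_def vol mult_ac)
    qed (use \<delta> len0 in auto)
    then show ?thesis using pP[OF zn] by (simp add: \<beta>_def)
  qed

  \<comment> \<open>Second stage: on the cell of \<open>x\<close> in the grid \<open>j'\<close>, the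
    difference of \<open>q1\<close> and \<open>q\<close> is a polynomial too.\<close>
  obtain n where xn: "x \<in> dyadic_cell j' n" using dyadic_cell_ex by blast
  obtain P where P: "P \<in> rat_polys r" and qP: "\<And>x. x \<in> dyadic_cell j' n \<Longrightarrow> q x = P x"
    using m_dir_on_cell[OF q] by blast
  have PC: "(\<lambda>x. q1 x - P x) \<in> coord_polys r"
    by (intro coord_polys_diff rat_polys_coord_polys P q1)
  have "\<bar>q1 x - P x\<bar> \<le> 2 * (5 / 4 * A + \<beta>)"
  proof (rule sup_le_of_averages[OF PC, where \<delta>=\<delta> and a="corner j' n" and l="len j'"])
    show "x \<in> cbox (corner j' n) (corner j' n + len j')"
      using dyadic_cell_cbox[OF xn] by (simp add: corner_def len_def)
    fix u assume u: "\<And>i. corner j' n $ i \<le> u $ i \<and> u $ i + \<delta> * len j' $ i \<le> corner j' n $ i + len j' $ i"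
    let ?B = "box u (u + \<delta> *\<^sub>R len j')"
    have sub: "t \<in> dyadic_interval (j' $ i) (n $ i) \<and> t \<in> dyadic_interval (c $ i) (N $ i)"
      if t: "t \<in> {u $ i<..<u $ i + \<delta> * len j' $ i}" for i t
    proof -
      have xi: "x $ i \<in> dyadic_interval (c $ i) (N $ i)" "x $ i \<in> dyadic_interval (j' $ i) (n $ i)"
        using xn xN by (auto simp: dyadic_cell_def)
      \<comment> \<open>Hence this cell lies in the coarse cell and the pointwise bound
        \<open>f1\<close> holds on all its windows.\<close>
      have "c $ i \<le> j' $ i" using T(1) by (simp add: c_def)
      note nested = dyadic_interval_nested[OF this xi]
      have "{u $ i<..<u $ i + \<delta> * len j' $ i} \<subseteq> dyadic_interval (j' $ i) (n $ i)"
        "{u $ i<..<u $ i + \<delta> * len j' $ i} \<subseteq> dyadic_interval (c $ i) (N $ i)"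
        using u[of i] nested
        by (intro dyadic_window_subset; simp add: corner_def len_def)+
      then show ?thesis using t by blast
    qed
    have cells: "x \<in> dyadic_cell j' n" "x \<in> dyadic_cell c N" if "x \<in> ?B" for x
      using that sub by (auto simp: mem_box_cart dyadic_cell_def)
    have ints: "set_integrable lborel ?B (\<lambda>x. q1 x - p x)" "set_integrable lborel ?B (\<lambda>x. p x - q x)"
      using int_pq set_integrable_coord_poly[OF q1] by auto
    \<comment> \<open>The first summand is bounded pointwise by \<beta>, the second in mean by
      \<open>bnd'\<close>.\<close>
    have "(LINT x:?B|lborel. q1 x - P x) = (LINT x:?B|lborel. (q1 x - p x) + (p x - q x))"
      by (rule set_lebesgue_integral_cong) (auto simp: qP[OF cells(1)])
    also have "\<dots> = (LINT x:?B|lborel. q1 x - p x) + (LINT x:?B|lborel. p x - q x)"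
      using ints by (rule set_integral_add)
    also have "\<bar>\<dots>\<bar> \<le> \<beta> * measure lborel ?B + 5 / 4 * A * measure lborel ?B"
    proof (rule order_trans[OF abs_triangle_ineq add_mono])
      have fin: "emeasure lborel ?B \<noteq> \<infinity>"
        using emeasure_lborel_box_finite[of u] by (metis infinity_ennreal_def less_irrefl)
      have const: "set_integrable lborel ?B (\<lambda>_. \<beta>)"
        using fin by (simp add: set_integrable_def less_top)
      have "\<bar>LINT x:?B|lborel. q1 x - p x\<bar> \<le> (LINT x:?B|lborel. \<bar>q1 x - p x\<bar>)"
        using set_integral_norm_bound[OF ints(1)] by simp
      also have "\<dots> \<le> (LINT x:?B|lborel. \<beta>)"
        using ints(1) const f1[OF cells(2)]
        by (intro set_integral_mono set_integrable_abs) (auto simp: abs_minus_commute)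
      also have "\<dots> = \<beta> * measure lborel ?B"
        using fin by (simp add: set_integral_const)
      finally show "\<bar>LINT x:?B|lborel. q1 x - p x\<bar> \<le> \<beta> * measure lborel ?B" .
    qed (rule bnd', simp)
    finally show "\<bar>LINT x:?B|lborel. q1 x - P x\<bar> \<le> (5 / 4 * A + \<beta>) * measure lborel ?B"
      by (simp add: algebra_simps)
  qed (use \<delta> len0 in auto)
  moreover have "\<bar>p x - q1 x\<bar> \<le> \<beta>" by (rule f1[OF xN])
  ultimately have "\<bar>p x - q x\<bar> \<le> \<beta> + 2 * (5 / 4 * A + \<beta>)"
    using qP[OF xn] by linarith
  also have "\<dots> = A * (5 / 2 + 15 / 2 * D)"
    by (simp add: \<beta>_def algebra_simps)
  finally show ?thesis by (simp add: D_def)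
qed

lemma model_h_pos:
  assumes "r \<noteq> 0"
  shows "0 < model_h r j"
proof -
  have "0 < (\<Prod>i\<in>UNIV. window_ratio r * 2 powi (- (j $ i)))"
    using window_ratio_bounds(1)[OF assms] by (intro prod_pos) simp
  then show ?thesis by (simp add: window_volume)
qed

text \<open>Either the directions in which the first grid is strictly coarser or the remaining ones
  carry a product of the \<open>r $ i + 1\<close> of size at most the square root of the full product;
  interpolate in those.\<close>

lemma two_grids_bound_sqrt:
  fixes r :: "nat^'d" and j j' :: "int^'d"
  assumes r: "r \<noteq> 0"
    and p: "p \<in> m_dir r (dyadic_partition j)" and q: "q \<in> m_dir r (dyadic_partition j')"
    and h: "h \<le> model_h r j" "h \<le> model_h r j'" and A: "0 \<le> A"
    and bnd: "\<And>u w. (\<And>i. 0 < w $ i) \<Longrightarrow> \<bar>LINT x:box u (u + w)|lborel. p x - q x\<bar>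
      \<le> A * (measure lborel (box u (u + w)) + h)"
  shows "\<bar>p x - q x\<bar> \<le> A * (4 * (1 + 4 * sqrt (real (\<Prod>i\<in>UNIV. r $ i + 1))))"
proof -
  define T where "T = {i. j $ i < j' $ i}"
  define D where "D B = real (\<Prod>i\<in>B. r $ i + 1)" for B
  have D0: "D B \<ge> 0" for B unfolding D_def by (rule of_nat_0_le_iff)
  have split: "D UNIV = D T * D (-T)"
    unfolding D_def of_nat_mult[symmetric] by (subst prod.union_disjoint[symmetric]) auto
  have final: "A * (5 / 2 + 15 / 2 * D B) \<le> A * (4 * (1 + 4 * sqrt (D UNIV)))"
    if "D B \<le> sqrt (D UNIV)" for B
  proof -
    \<comment> \<open>There is slack here: 5/2 is at most 4 and 15/2 at most 16.\<close>
    have "5 / 2 + 15 / 2 * a \<le> 4 * (1 + 4 * s)" if "0 \<le> a" "a \<le> s" for a s :: real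
      using that by (simp add: distrib_left)
    from this[OF D0 that] A show ?thesis by (rule mult_left_mono)
  qed
  show ?thesis
  proof (cases "D T \<le> D (-T)")
    case True
    then have "D T \<le> sqrt (D UNIV)"
      unfolding split using D0[of T] by (intro real_le_rsqrt) (simp add: power2_eq_square mult_left_mono)
    from final[OF this] show ?thesis
      using two_grids_bound[OF r _ _ p q h A bnd, of T x] by (fastforce simp: T_def D_def)
  next
    case False
    then have "D (-T) \<le> sqrt (D UNIV)"
      unfolding split using D0[of "-T"] by (intro real_le_rsqrt) (simp add: power2_eq_square mult_right_mono)
    note fin = final[OF this]
    have "\<bar>q x - p x\<bar> \<le> A * (5 / 2 + 15 / 2 * D (-T))"
      unfolding D_def
    proof (rule two_grids_bound[OF r _ _ q p h(2,1) A])
      fix u w :: "real^'d" assume w: "\<And>i. 0 < w $ i"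
      have "(LINT x:box u (u + w)|lborel. q x - p x) = - (LINT x:box u (u + w)|lborel. p x - q x)"
        by (simp add: set_lebesgue_integral_def algebra_simps flip: Bochner_Integration.integral_minus)
      then show "\<bar>LINT x:box u (u + w)|lborel. q x - p x\<bar> \<le> A * (measure lborel (box u (u + w)) + h)"
        using bnd[OF w, of u] by simp
    qed (auto simp: T_def)
    with fin show ?thesis by (simp add: abs_minus_commute D_def)
  qed
qed

section \<open>From pointwise bounds to the norm ratio\<close>

text \<open>Every quotient is at most the L1 norm divided by \<open>h\<close>. Finiteness lets the
  rectangle norm itself serve as the real bound \<open>A\<close>.\<close>

lemma rect_norm_finite:
  assumes f: "integrable lborel f" and h: "0 < h"
  shows "rect_norm h f < \<infinity>"
proof -
  define B where "B = (LINT x|lborel. \<bar>f x\<bar>) / h"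
  have "rect_norm h f \<le> ennreal B"
    unfolding rect_norm_def
  proof (rule SUP_least, rule ennreal_leI)
    fix C :: "(real^'a) set" assume "C \<in> open_rectangles"
    then have C: "C \<in> sets lborel" by (auto simp: open_rectangles_def)
    have int: "set_integrable lborel C f"
      unfolding set_integrable_def by (rule integrable_mult_indicator[OF C f])
    have "\<bar>LINT x:C|lborel. f x\<bar> \<le> (LINT x:C|lborel. \<bar>f x\<bar>)"
      using set_integral_norm_bound[OF int] by simp
    also have "\<dots> \<le> (LINT x|lborel. \<bar>f x\<bar>)"
      unfolding set_lebesgue_integral_def
      using f C by (intro integral_mono integrable_mult_indicator) (auto simp: indicator_def)
    finally show "\<bar>LINT x:C|lborel. f x\<bar> / (measure lborel C + h) \<le> B"
      unfolding B_def using h by (intro frac_le) auto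
  qed
  then show ?thesis by (simp add: le_less_trans less_top)
qed

lemma rect_norm_bound:
  assumes "rect_norm h f \<le> ennreal A" "0 \<le> A" "0 < h" "\<And>i. 0 < w $ i"
  shows "\<bar>LINT x:box u (u + w)|lborel. f x\<bar> \<le> A * (measure lborel (box u (u + w)) + h)"
proof -
  let ?C = "box u (u + w)"
  have "?C \<in> open_rectangles" unfolding open_rectangles_def
    by (intro CollectI exI[of _ u] exI[of _ "u + w"] conjI refl allI) (simp add: assms(4))
  then have "ennreal (\<bar>LINT x:?C|lborel. f x\<bar> / (measure lborel ?C + h)) \<le> rect_norm h f"
    unfolding rect_norm_def by (rule SUP_upper)
  also note assms(1)
  finally have "\<bar>LINT x:?C|lborel. f x\<bar> / (measure lborel ?C + h) \<le> A"
    using assms(2) by (simp add: ennreal_le_iff)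
  moreover have "0 < measure lborel ?C + h" using assms(3) by (simp add: add_nonneg_pos)
  ultimately show ?thesis by (simp add: pos_divide_le_eq)
qed

lemma ess_norm_le:
  assumes "f \<in> borel_measurable borel" "\<And>x. \<bar>f x\<bar> \<le> B"
  shows "ess_norm f \<le> ennreal B"
  unfolding ess_norm_def
  using assms by (intro esssup_I) (auto intro: ennreal_leI)

lemma norm_ratio_ge:
  assumes f: "integrable lborel f" and h: "0 < h" and K: "0 < K"
    and bnd: "\<And>A x. 0 \<le> A \<Longrightarrow> rect_norm h f \<le> ennreal A \<Longrightarrow> \<bar>f x\<bar> \<le> A * K" and K1: "1 \<le> K"
  shows "ennreal (inverse K) \<le> norm_ratio h f"
proof -
  obtain A where A: "0 \<le> A" "rect_norm h f = ennreal A"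
    using rect_norm_finite[OF f h] by (cases "rect_norm h f") auto
  have ess: "ess_norm f \<le> ennreal (A * K)"
    using borel_measurable_integrable[OF f] bnd[OF A(1)] A(2) by (intro ess_norm_le) auto
  then obtain E where E: "0 \<le> E" "ess_norm f = ennreal E"
    by (cases "ess_norm f") (auto simp: top_unique)
  have EA: "E \<le> A * K" using ess E A K by (simp add: ennreal_le_iff)
  show ?thesis
  \<comment> \<open>For \<open>E = 0\<close> the ratio is 1 by convention if \<open>A = 0\<close>,
    where \<open>K1\<close> is used, and infinite by division in \<open>ennreal\<close>
    otherwise.\<close>
  proof (cases "E = 0")
    case True
    then show ?thesis
      using A E K1 by (cases "A = 0") (auto simp: norm_ratio_def inverse_le_1_iff ennreal_divide_zero
        simp flip: ennreal_1 intro!: ennreal_leI)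
  next
    case False
    then have "0 < E" using E by simp
    then have "inverse K \<le> A / E" using EA K by (simp add: field_simps)
    moreover have "norm_ratio h f = ennreal (A / E)"
      using A E \<open>0 < E\<close> by (simp add: norm_ratio_def divide_ennreal)
    ultimately show ?thesis by (simp add: ennreal_leI)
  qed
qed

theorem theorem5:
  fixes r :: "nat^'d" and j j' :: "int^'d" and m m' :: "(real^'d \<Rightarrow> real) set"
  assumes "r \<noteq> 0"
    and "m = m_dir r (dyadic_partition j)"
    and "m' = m_dir r (dyadic_partition j')"
  shows "kappa (m \<union> m') (min (model_h r j) (model_h r j'))
    \<ge> ennreal (inverse (4 * (1 + 4 * sqrt (real (\<Prod>i\<in>UNIV. r $ i + 1)))))"
proof -
  define h where "h = min (model_h r j) (model_h r j')"
  define K where "K = 4 * (1 + 4 * sqrt (real (\<Prod>i\<in>UNIV. r $ i + 1)))"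
  have h: "0 < h" using model_h_pos[OF assms(1)] by (simp add: h_def)
  have "1 \<le> 4 * (1 + 4 * s)" if "0 \<le> s" for s :: real
    using that by simp
  from this[OF real_sqrt_ge_zero[OF of_nat_0_le_iff]] have K: "1 \<le> K"
    unfolding K_def .
  have "ennreal (inverse K) \<le> norm_ratio h (\<lambda>x. p x - q x)" if pq: "p \<in> m \<union> m'" "q \<in> m \<union> m'" for p q
  proof -
    \<comment> \<open>Functions from the same model and from different models are treated alike,
      since the bound for two grids allows the grids to coincide.\<close>
    obtain k k' where p: "p \<in> m_dir r (dyadic_partition k)" "h \<le> model_h r k"
      and q: "q \<in> m_dir r (dyadic_partition k')" "h \<le> model_h r k'"
      using pq assms(2,3) unfolding h_def by (metis Un_iff min.cobounded1 min.cobounded2)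
    show ?thesis
    proof (rule norm_ratio_ge[OF _ h])
      show "integrable lborel (\<lambda>x. p x - q x)"
        using m_dir_integrable[OF p(1)] m_dir_integrable[OF q(1)] by simp
      fix A x assume A: "0 \<le> A" "rect_norm h (\<lambda>x. p x - q x) \<le> ennreal A"
      show "\<bar>p x - q x\<bar> \<le> A * K"
        unfolding K_def
        by (rule two_grids_bound_sqrt[OF assms(1) p(1) q(1) p(2) q(2) A(1)])
          (rule rect_norm_bound[OF A(2,1) h])
    qed (use K in auto)
  qed
  then show ?thesis
    unfolding kappa_def h_def[symmetric] K_def[symmetric] by (intro INF_greatest)
qed

end
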